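(* Let $(M,g)$ be a properly embedded Riemannian submanifold of $\mathbb R^d$ and let $\gamma:M\times M\to TM$, $\gamma(x,y)=\Pi_x(y-x)$. Define $\gamma^{\mathbf{cl}}:TM\times TM\to TTM$ by $$\gamma^{\mathbf{cl}}(\mathbf U,\mathbf V):=s_M\big(d\gamma(\mathbf U,\mathbf V)\big).$$ Then for $\mathbf U\in T_xM$, $\mathbf V\in T_yM$, $$\gamma^{\mathbf{cl}}(\mathbf U,\mathbf V)=\big(\gamma(x,y),\,\mathrm{II}(\gamma(x,y),\mathbf U)\big)+\big(0,\,-A_{\Pi_x^\perp(y-x)}\mathbf U+\Pi_x(\mathbf V-\mathbf U)\big),$$ and $\gamma^{\mathbf{cl}}$ is a connection rule on the manifold $TM$.
   Context: $\Pi_x:\mathbb R^d\to T_xM$ and $\Pi_x^\perp:\mathbb R^d\to T_x^\perp M$ are the orthogonal projections. With $D$ the flat covariant derivative of $\mathbb R^d$ and $\nabla$ the Levi-Civita connection of $M$, the second fundamental form $\mathrm{II}$ and Weingarten map $A$ are given by $D_{\mathcal X}\mathcal Y=\nabla_{\mathcal X}\mathcal Y+\mathrm{II}(\mathcal X,\mathcal Y)$ and $g(A_\xi\mathcal X,\mathcal Y)=-\langle\xi,\mathrm{II}(\mathcal X,\mathcal Y)\rangle$ for vector fields $\mathcal X,\mathcal Y$ on $M$ and normal fields $\xi$. Via the embedding, $TM\subset\mathbb R^d\times\mathbb R^d$ and $TTM\subset(\mathbb R^d)^4$; an element of $T_{\mathbf U}TM$ is written as the pair of its last two $\mathbb R^d$-components.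 $d\gamma:T(M\times M)=TM\times TM\to TTM$ is the differential of $\gamma$. The canonical flip $s_M:TTM\to TTM$ is $s_M(\partial_t|_{t=0}\partial_s|_{s=0}x(s,t))=\partial_s|_{s=0}\partial_t|_{t=0}x(s,t)$ for smooth $(s,t)\mapsto x(s,t)\in M$ (on $(\mathbb R^d)^4$ it exchanges the second and third components). A connection rule on a manifold $N$ is a Borel measurable map $c:N\times N\to TN$ that is $C^2$ on a neighborhood of the diagonal and satisfies, for all $x,y\in N$: (i) $c(x,y)\in T_xN$; (ii) $c(x,x)=0$; (iii) $(d\,c(x,\cdot))_x=\mathrm{id}_{T_xN}$. *)

theory Defs
  imports "HOL-Analysis.Analysis"
begin

section \<open>Smooth maps and embedded submanifolds of Euclidean space\<close>

text \<open>
  On an open set, \<open>f\<close> is \<open>C\<^sup>k\<close> if all iterated directional derivatives of order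
  less than \<open>k\<close> are (Frechet) differentiable and those of order \<open>k\<close> are continuous.
\<close>

primrec ck_open :: "nat \<Rightarrow> 'a::euclidean_space set \<Rightarrow> ('a \<Rightarrow> 'b::euclidean_space) \<Rightarrow> bool" where
  "ck_open 0 U f \<longleftrightarrow> continuous_on U f"
| "ck_open (Suc k) U f \<longleftrightarrow> (\<forall>x\<in>U. f differentiable (at x)) \<and>
     (\<forall>v. ck_open k U (\<lambda>x. frechet_derivative f (at x) v))"

definition smooth_open :: "'a::euclidean_space set \<Rightarrow> ('a \<Rightarrow> 'b::euclidean_space) \<Rightarrow> bool" where
  "smooth_open U f \<longleftrightarrow> (\<forall>k. ck_open k U f)"

text \<open>
  A map on an arbitrary subset (in practice a relatively open subset of an embedded
  submanifold) is \<open>C\<^sup>k\<close> or smooth if it has such an extension locally.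
\<close>

definition ck_map :: "nat \<Rightarrow> 'a::euclidean_space set \<Rightarrow> ('a \<Rightarrow> 'b::euclidean_space) \<Rightarrow> bool" where
  "ck_map k S f \<longleftrightarrow>
     (\<forall>p\<in>S. \<exists>U F. open U \<and> p \<in> U \<and> ck_open k U F \<and> (\<forall>x\<in>S \<inter> U. F x = f x))"

definition smooth_map :: "'a::euclidean_space set \<Rightarrow> ('a \<Rightarrow> 'b::euclidean_space) \<Rightarrow> bool" where
  "smooth_map S f \<longleftrightarrow>
     (\<forall>p\<in>S. \<exists>U F. open U \<and> p \<in> U \<and> smooth_open U F \<and> (\<forall>x\<in>S \<inter> U. F x = f x))"

definition embedded_submanifold :: "nat \<Rightarrow> 'a::euclidean_space set \<Rightarrow> bool" where
  "embedded_submanifold n N \<longleftrightarrow>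
     (\<forall>p\<in>N. \<exists>U V \<phi> \<psi> (S :: 'a set).
        open U \<and> p \<in> U \<and> open V \<and> smooth_open U \<phi> \<and> smooth_open V \<psi> \<and>
        homeomorphism U V \<phi> \<psi> \<and> subspace S \<and> dim S = n \<and> \<phi> ` (N \<inter> U) = S \<inter> V)"

definition properly_embedded :: "'a::euclidean_space set \<Rightarrow> bool" where
  "properly_embedded N \<longleftrightarrow> proper_map (top_of_set N) euclidean (\<lambda>x. x)"

definition tangent_space :: "'a::euclidean_space set \<Rightarrow> 'a \<Rightarrow> 'a set" where
  "tangent_space N x =
     {v. \<exists>(c :: real \<Rightarrow> 'a) e. 0 < e \<and> smooth_open {-e<..<e} c \<and> c ` {-e<..<e} \<subseteq> N \<and>
         c 0 = x \<and> (c has_vector_derivative v) (at 0)}"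

definition tangent_bundle :: "'a::euclidean_space set \<Rightarrow> ('a \<times> 'a) set" where
  "tangent_bundle N = {(x, v). x \<in> N \<and> v \<in> tangent_space N x}"

abbreviation normal_space_at :: "'a::euclidean_space set \<Rightarrow> 'a \<Rightarrow> 'a set" where
  "normal_space_at N x \<equiv> orthogonal_comp (tangent_space N x)"

text \<open>
  Derivatives within \<open>N\<close> are in general not unique as linear maps on the ambient space, but
  any two of them agree on the tangent space. So \<open>mdiff N f x v\<close>, the differential of
  \<open>f : N \<rightarrow> 'b\<close> at \<open>x\<close>, is meaningful exactly for \<open>v\<close> tangent to \<open>N\<close> at \<open>x\<close>.
\<close>

definition mdiff ::
  "'a::euclidean_space set \<Rightarrow> ('a \<Rightarrow> 'b::euclidean_space) \<Rightarrow> 'a \<Rightarrow> 'a \<Rightarrow> 'b" where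
  "mdiff N f x v = frechet_derivative f (at x within N) v"

definition tangent_map ::
  "'a::euclidean_space set \<Rightarrow> ('a \<Rightarrow> 'b::euclidean_space) \<Rightarrow> 'a \<times> 'a \<Rightarrow> 'b \<times> 'b" where
  "tangent_map N f = (\<lambda>(x, v). (f x, mdiff N f x v))"


section \<open>Levi-Civita connection, second fundamental form, Weingarten map\<close>

definition riemannian_submanifold ::
  "nat \<Rightarrow> 'a::euclidean_space set \<Rightarrow> ('a \<Rightarrow> 'a \<Rightarrow> 'a \<Rightarrow> real) \<Rightarrow> bool" where
  "riemannian_submanifold n M g \<longleftrightarrow> embedded_submanifold n M \<and>
     (\<forall>x\<in>M. \<forall>u\<in>tangent_space M x. \<forall>v\<in>tangent_space M x. g x u v = inner u v)"

definition vector_field :: "'a::euclidean_space set \<Rightarrow> ('a \<Rightarrow> 'a) \<Rightarrow> bool" where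
  "vector_field M X \<longleftrightarrow> smooth_map M X \<and> (\<forall>x\<in>M. X x \<in> tangent_space M x)"

definition normal_field :: "'a::euclidean_space set \<Rightarrow> ('a \<Rightarrow> 'a) \<Rightarrow> bool" where
  "normal_field M \<xi> \<longleftrightarrow> smooth_map M \<xi> \<and> (\<forall>x\<in>M. \<xi> x \<in> normal_space_at M x)"

text \<open>
  \<open>D\<^sub>X Y\<close> for a map \<open>Y\<close> from \<open>M\<close> to a Euclidean space; for real-valued \<open>Y\<close> this is the
  function \<open>X Y\<close>.
\<close>

definition flat_D ::
  "'a::euclidean_space set \<Rightarrow> ('a \<Rightarrow> 'a) \<Rightarrow> ('a \<Rightarrow> 'b::euclidean_space) \<Rightarrow> 'a \<Rightarrow> 'b" where
  "flat_D M X Y x = mdiff M Y x (X x)"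

text \<open>
  The components of the Lie bracket are \<open>X (Y\<^sup>i) - Y (X\<^sup>i)\<close>, the superscript referring to the
  coordinates of the ambient space.
\<close>

definition lie_bracket ::
  "'a::euclidean_space set \<Rightarrow> ('a \<Rightarrow> 'a) \<Rightarrow> ('a \<Rightarrow> 'a) \<Rightarrow> 'a \<Rightarrow> 'a" where
  "lie_bracket M X Y x = flat_D M X Y x - flat_D M Y X x"

text \<open>
  Vector fields are total functions of which only the values on \<open>M\<close> matter; the second
  clause says that a connection respects this.
\<close>

definition affine_connection ::
  "'a::euclidean_space set \<Rightarrow> (('a \<Rightarrow> 'a) \<Rightarrow> ('a \<Rightarrow> 'a) \<Rightarrow> 'a \<Rightarrow> 'a) \<Rightarrow> bool" where
  "affine_connection M nabla \<longleftrightarrow>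
     (\<forall>X Y. vector_field M X \<longrightarrow> vector_field M Y \<longrightarrow> vector_field M (nabla X Y)) \<and>
     (\<forall>X X' Y Y'. vector_field M X \<longrightarrow> vector_field M X' \<longrightarrow>
        vector_field M Y \<longrightarrow> vector_field M Y' \<longrightarrow>
        (\<forall>x\<in>M. X x = X' x \<and> Y x = Y' x) \<longrightarrow> (\<forall>x\<in>M. nabla X Y x = nabla X' Y' x)) \<and>
     (\<forall>X Y Z. vector_field M X \<longrightarrow> vector_field M Y \<longrightarrow> vector_field M Z \<longrightarrow>
        (\<forall>x\<in>M. nabla (\<lambda>y. X y + Y y) Z x = nabla X Z x + nabla Y Z x) \<and>
        (\<forall>x\<in>M. nabla Z (\<lambda>y. X y + Y y) x = nabla Z X x + nabla Z Y x)) \<and>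
     (\<forall>(f :: 'a \<Rightarrow> real) X Y. smooth_map M f \<longrightarrow> vector_field M X \<longrightarrow> vector_field M Y \<longrightarrow>
        (\<forall>x\<in>M. nabla (\<lambda>y. f y *\<^sub>R X y) Y x = f x *\<^sub>R nabla X Y x) \<and>
        (\<forall>x\<in>M. nabla X (\<lambda>y. f y *\<^sub>R Y y) x = flat_D M X f x *\<^sub>R Y x + f x *\<^sub>R nabla X Y x))"

definition levi_civita ::
  "'a::euclidean_space set \<Rightarrow> ('a \<Rightarrow> 'a \<Rightarrow> 'a \<Rightarrow> real) \<Rightarrow>
     (('a \<Rightarrow> 'a) \<Rightarrow> ('a \<Rightarrow> 'a) \<Rightarrow> 'a \<Rightarrow> 'a) \<Rightarrow> bool" where
  "levi_civita M g nabla \<longleftrightarrow> affine_connection M nabla \<and>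
     (\<forall>X Y. vector_field M X \<longrightarrow> vector_field M Y \<longrightarrow>
        (\<forall>x\<in>M. nabla X Y x - nabla Y X x = lie_bracket M X Y x)) \<and>
     (\<forall>X Y Z. vector_field M X \<longrightarrow> vector_field M Y \<longrightarrow> vector_field M Z \<longrightarrow>
        (\<forall>x\<in>M. flat_D M X (\<lambda>y. g y (Y y) (Z y)) x =
                 g x (nabla X Y x) (Z x) + g x (Y x) (nabla X Z x)))"

text \<open>
  \<open>II\<close> takes the base point and two tangent vectors, the Weingarten map \<open>A\<close> the base point,
  a normal vector and a tangent vector.
\<close>

definition second_fundamental_form ::
  "'a::euclidean_space set \<Rightarrow> (('a \<Rightarrow> 'a) \<Rightarrow> ('a \<Rightarrow> 'a) \<Rightarrow> 'a \<Rightarrow> 'a) \<Rightarrow>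
     ('a \<Rightarrow> 'a \<Rightarrow> 'a \<Rightarrow> 'a) \<Rightarrow> bool" where
  "second_fundamental_form M nabla II \<longleftrightarrow>
     (\<forall>X Y. vector_field M X \<longrightarrow> vector_field M Y \<longrightarrow>
        (\<forall>x\<in>M. flat_D M X Y x = nabla X Y x + II x (X x) (Y x)))"

definition weingarten_map ::
  "'a::euclidean_space set \<Rightarrow> ('a \<Rightarrow> 'a \<Rightarrow> 'a \<Rightarrow> real) \<Rightarrow>
     ('a \<Rightarrow> 'a \<Rightarrow> 'a \<Rightarrow> 'a) \<Rightarrow> ('a \<Rightarrow> 'a \<Rightarrow> 'a \<Rightarrow> 'a) \<Rightarrow> bool" where
  "weingarten_map M g II A \<longleftrightarrow>
     (\<forall>\<xi> X Y. normal_field M \<xi> \<longrightarrow> vector_field M X \<longrightarrow> vector_field M Y \<longrightarrow>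
        (\<forall>x\<in>M. A x (\<xi> x) (X x) \<in> tangent_space M x \<and>
                 g x (A x (\<xi> x) (X x)) (Y x) = - inner (\<xi> x) (II x (X x) (Y x))))"


section \<open>Canonical flip\<close>

definition velocity :: "(real \<Rightarrow> 'a::euclidean_space) \<Rightarrow> 'a \<times> 'a" where
  "velocity c = (c 0, vector_derivative c (at 0))"

text \<open>
  For a family \<open>x(s,t)\<close> in \<open>M\<close>, \<open>velocity (\<lambda>t. velocity (\<lambda>s. x (s, t)))\<close> is the element
  \<open>\<partial>\<^sub>t\<partial>\<^sub>s x\<close> at \<open>s = t = 0\<close> of \<open>TTM\<close>; the inner velocity is a curve in \<open>TM\<close>.
\<close>

definition canonical_flip ::
  "'a::euclidean_space set \<Rightarrow> ('a \<times> 'a) \<times> ('a \<times> 'a) \<Rightarrow> ('a \<times> 'a) \<times> ('a \<times> 'a)" where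
  "canonical_flip M w = (THE w'. \<exists>(x :: real \<times> real \<Rightarrow> 'a) W.
     open W \<and> (0, 0) \<in> W \<and> smooth_open W x \<and> x ` W \<subseteq> M \<and>
     w = velocity (\<lambda>t. velocity (\<lambda>s. x (s, t))) \<and>
     w' = velocity (\<lambda>s. velocity (\<lambda>t. x (s, t))))"


section \<open>Connection rules\<close>

text \<open>
  An element of \<open>T\<^sub>x N\<close> is the pair of its base point and a vector. In the last clause, the
  map \<open>c(x,\<cdot>)\<close> takes values in the vector space \<open>T\<^sub>x N\<close>, hence the \<open>snd\<close>; its differential
  is required only to be the identity on tangent vectors.
\<close>

definition connection_rule ::
  "'a::euclidean_space set \<Rightarrow> ('a \<times> 'a \<Rightarrow> 'a \<times> 'a) \<Rightarrow> bool" where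
  "connection_rule N c \<longleftrightarrow>
     (\<exists>n. embedded_submanifold n N) \<and>
     c \<in> measurable (restrict_space borel (N \<times> N)) (restrict_space borel (tangent_bundle N)) \<and>
     (\<exists>W. open W \<and> (\<forall>x\<in>N. (x, x) \<in> W) \<and> ck_map 2 (W \<inter> (N \<times> N)) c) \<and>
     (\<forall>x\<in>N. \<forall>y\<in>N. fst (c (x, y)) = x \<and> snd (c (x, y)) \<in> tangent_space N x) \<and>
     (\<forall>x\<in>N. c (x, x) = (x, 0)) \<and>
     (\<forall>x\<in>N. \<exists>L. ((\<lambda>y. snd (c (x, y))) has_derivative L) (at x within N) \<and>
        (\<forall>v\<in>tangent_space N x. L v = v))"

definition orth_proj :: "'a::euclidean_space set \<Rightarrow> 'a \<Rightarrow> 'a" where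
  "orth_proj S v = (THE p. p \<in> S \<and> v - p \<in> orthogonal_comp S)"

definition gamma :: "'a::euclidean_space set \<Rightarrow> 'a \<times> 'a \<Rightarrow> 'a \<times> 'a" where
  "gamma M = (\<lambda>(x, y). (x, orth_proj (tangent_space M x) (y - x)))"

text \<open>
  \<open>T(M \<times> M)\<close>, whose elements are \<open>((x, y), (u, v))\<close>, is identified with \<open>TM \<times> TM\<close>,
  whose elements are \<open>((x, u), (y, v))\<close>.
\<close>

definition gamma_cl ::
  "'a::euclidean_space set \<Rightarrow> ('a \<times> 'a) \<times> ('a \<times> 'a) \<Rightarrow> ('a \<times> 'a) \<times> ('a \<times> 'a)" where
  "gamma_cl M = (\<lambda>((x, u), (y, v)).
     canonical_flip M (tangent_map (M \<times> M) (gamma M) ((x, y), (u, v))))"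

end

theory Submission
  imports Defs
begin

text \<open>
  A chart gives smooth retractions \<open>r\<close> of neighbourhoods onto \<open>M\<close>, and \<open>T\<^sub>x M\<close> is the range of
  the idempotent \<open>Dr(x)\<close>; hence the orthogonal projection \<open>P(x)\<close> onto \<open>T\<^sub>x M\<close> depends smoothly
  on \<open>x\<close>. Differentiating \<open>\<gamma>(x, y) = (x, P(x)(y - x))\<close> gives
  \<open>(u, dP(u)(y - x) + P(x)(v - u))\<close> as the vector part of \<open>d\<gamma>(u, v)\<close>. Differentiating \<open>P\<^sup>2 = P\<close>
  shows that \<open>dP(u)\<close> exchanges tangent and normal vectors, and by Koszul's argument
  \<open>dP(u)\<close> is \<open>II(u, \<cdot>)\<close> on tangent and \<open>- A u\<close> on normal vectors. Extending a curve
  \<open>(c(t), a(t))\<close> in \<open>TM\<close> to the family \<open>r(c(t) + s a(t))\<close> evaluates the canonical flip, and the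
  formula obtained is smooth on all of \<open>TM \<times> TM\<close>, not only near the diagonal. That its derivative on the
  diagonal is the identity is the symmetry of \<open>II\<close>.
\<close>

section \<open>Calculus of smooth maps\<close>

text \<open>Three obstacles shape the proof. The objects \<open>nabla\<close>, \<open>II\<close> and
  \<open>A\<close> are specified only through their action on smooth fields, while the formula
  concerns single vectors. The fields \<open>\<lambda>y. tproj M y w\<close> bridge this gap: they
  are smooth because the projection is, they take the value \<open>w\<close> wherever
  \<open>w\<close> is tangent, and their flat derivative is \<open>dproj\<close>. At a point where
  \<open>u\<close> and \<open>w\<close> are tangent, the Levi-Civita axioms force the covariant
  derivative of such fields to vanish, so only the normal part survives. The derivative of a
  retraction is merely an oblique projection onto the tangent space. The orthogonal one is produced
  from it by inverting an operator, which is why smoothness of inverses of operator families is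
  developed. Finally, \<open>canonical_flip\<close> is a definite description over families:
  existence asks for a family through the given vector, and uniqueness is the symmetry of second
  derivatives. Derivatives within \<open>M\<close> are not unique as ambient linear maps, so
  differentials are computed from extensions to open sets and compared along curves.\<close>

lemma ck_open_SucD:
  assumes "ck_open (Suc k) U f"
  shows "x \<in> U \<Longrightarrow> (f has_derivative frechet_derivative f (at x)) (at x)"
    and "ck_open k U (\<lambda>x. frechet_derivative f (at x) v)"
  using assms by (auto simp: frechet_derivative_works)

text \<open>Openness is essential: agreement on an open set passes to the derivatives, which carries
  the induction.\<close>

lemma ck_open_cong:
  assumes "open U" "\<And>x. x \<in> U \<Longrightarrow> f x = g x" "ck_open k U f"
  shows "ck_open k U g"
  using assms(2,3)
proof (induction k arbitrary: f g)
  case 0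
  then show ?case using continuous_on_cong[of U U f g] by simp
next
  case (Suc k)
  have f': "(g has_derivative frechet_derivative f (at x)) (at x)" if "x \<in> U" for x
    by (rule has_derivative_transform_within_open[OF ck_open_SucD(1)[OF Suc.prems(2) that] assms(1) that])
      (rule Suc.prems(1))
  then have eq: "frechet_derivative g (at x) = frechet_derivative f (at x)" if "x \<in> U" for x
    using that by (metis frechet_derivative_at)
  have "ck_open k U (\<lambda>x. frechet_derivative g (at x) v)" for v
    using Suc.IH[of "\<lambda>x. frechet_derivative f (at x) v" "\<lambda>x. frechet_derivative g (at x) v"]
      Suc.prems eq by simp
  with f' show ?case by (auto simp: differentiable_def)
qed

text \<open>Lets an explicit derivative formula replace \<open>frechet_derivative\<close>; the
  closure rules below all go through it.\<close>

lemma ck_open_SucI: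
  assumes "open U" "\<And>x. x \<in> U \<Longrightarrow> (f has_derivative f' x) (at x)"
    and "\<And>v. ck_open k U (\<lambda>x. f' x v)"
  shows "ck_open (Suc k) U f"
proof -
  have eq: "frechet_derivative f (at x) = f' x" if "x \<in> U" for x
    using assms(2)[OF that] by (metis frechet_derivative_at)
  have "ck_open k U (\<lambda>x. frechet_derivative f (at x) v)" for v
    using ck_open_cong[OF assms(1) _ assms(3)[of v]] eq by simp
  then show ?thesis using assms(2) by (auto simp: differentiable_def)
qed

lemma ck_open_Suc_imp: "ck_open (Suc k) U f \<Longrightarrow> ck_open k U f"
proof (induction k arbitrary: f)
  case 0
  then have "f differentiable at x" if "x \<in> U" for x
    using that by simp
  then show ?case
    by (auto intro!: differentiable_imp_continuous_on differentiable_at_imp_differentiable_on)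
next
  case (Suc k)
  then show ?case by auto
qed

lemma ck_open_continuous: "ck_open k U f \<Longrightarrow> continuous_on U f"
proof (induction k)
  case (Suc k)
  then show ?case using ck_open_Suc_imp by blast
qed simp

lemma ck_open_subset: "ck_open k U f \<Longrightarrow> V \<subseteq> U \<Longrightarrow> ck_open k V f"
proof (induction k arbitrary: f)
  case 0
  then show ?case by (auto intro: continuous_on_subset)
qed auto

lemma ck_open_const: "ck_open k U (\<lambda>x. c)"
  by (induction k arbitrary: c) auto

lemma ck_open_bounded_linear:
  assumes "bounded_linear T" "open U"
  shows "ck_open k U T"
proof (cases k)
  case 0
  then show ?thesis using assms linear_continuous_on by simp
next
  case (Suc j)
  then show ?thesis
    using ck_open_SucI[OF assms(2) bounded_linear.has_derivative[OF assms(1) has_derivative_ident]]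
      ck_open_const by blast
qed

lemma ck_open_linear_comp:
  assumes "bounded_linear T" "open U"
  shows "ck_open k U f \<Longrightarrow> ck_open k U (\<lambda>x. T (f x))"
proof (induction k arbitrary: f)
  case 0
  then show ?case using bounded_linear.continuous_on[OF assms(1)] by simp
next
  case (Suc k)
  show ?case
    using ck_open_SucI[OF assms(2) bounded_linear.has_derivative[OF assms(1) ck_open_SucD(1)[OF Suc.prems]]
        Suc.IH[OF ck_open_SucD(2)[OF Suc.prems]]] by blast
qed

lemma ck_open_add:
  assumes "open U"
  shows "ck_open k U f \<Longrightarrow> ck_open k U g \<Longrightarrow> ck_open k U (\<lambda>x. f x + g x)"
proof (induction k arbitrary: f g)
  case 0
  then show ?case by (auto intro: continuous_intros)
next
  case (Suc k)
  show ?case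
    using ck_open_SucI[OF assms has_derivative_add[OF ck_open_SucD(1)[OF Suc.prems(1)]
          ck_open_SucD(1)[OF Suc.prems(2)]] Suc.IH[OF ck_open_SucD(2)[OF Suc.prems(1)]
          ck_open_SucD(2)[OF Suc.prems(2)]]] by blast
qed

lemma ck_open_sum:
  assumes "open U" "\<And>i. i \<in> I \<Longrightarrow> ck_open k U (f i)"
  shows "ck_open k U (\<lambda>x. \<Sum>i\<in>I. f i x)"
  using assms(2)
  by (induction I rule: infinite_finite_induct) (auto intro: ck_open_const ck_open_add[OF assms(1)])

text \<open>The product rule turns one product into two products of one order less, each with one
  factor undifferentiated.\<close>

lemma ck_open_bilinear:
  assumes "bounded_bilinear h" "open U"
  shows "ck_open k U f \<Longrightarrow> ck_open k U g \<Longrightarrow> ck_open k U (\<lambda>x. h (f x) (g x))"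
proof (induction k arbitrary: f g)
  case 0
  then show ?case using bounded_bilinear.continuous_on[OF assms(1)] by simp
next
  case (Suc k)
  have f: "ck_open k U f" and g: "ck_open k U g" using Suc.prems ck_open_Suc_imp by blast+
  show ?case
  proof (rule ck_open_SucI[OF assms(2)])
    show "((\<lambda>x. h (f x) (g x)) has_derivative (\<lambda>v. h (f x) (frechet_derivative g (at x) v) +
            h (frechet_derivative f (at x) v) (g x))) (at x)" if "x \<in> U" for x
      using Suc.prems that by (intro bounded_bilinear.FDERIV[OF assms(1)] ck_open_SucD(1))
    show "ck_open k U (\<lambda>x. h (f x) (frechet_derivative g (at x) v) +
            h (frechet_derivative f (at x) v) (g x))" for v
      by (intro ck_open_add[OF assms(2)] Suc.IH f g ck_open_SucD(2)[OF Suc.prems(1)]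
          ck_open_SucD(2)[OF Suc.prems(2)])
  qed
qed

lemma linear_Basis_expand:
  fixes f :: "'a::euclidean_space \<Rightarrow> 'b::real_vector"
  assumes "linear f"
  shows "f v = (\<Sum>b\<in>Basis. (v \<bullet> b) *\<^sub>R f b)"
proof -
  have "f v = f (\<Sum>b\<in>Basis. (v \<bullet> b) *\<^sub>R b)" by (simp add: euclidean_representation)
  then show ?thesis using assms by (simp add: linear_sum linear_scale)
qed

text \<open>Regularity of an operator family is expressed vector by vector, which avoids a topology
  on operators; expanding the argument in the basis leaves a finite sum of products.\<close>

lemma ck_open_apply_linear:
  fixes F :: "'a::euclidean_space \<Rightarrow> 'b::euclidean_space \<Rightarrow> 'c::euclidean_space"
  assumes "open U" "\<And>x. x \<in> U \<Longrightarrow> linear (F x)" "\<And>b. ck_open k U (\<lambda>x. F x b)"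
    and "ck_open k U g"
  shows "ck_open k U (\<lambda>x. F x (g x))"
proof (rule ck_open_cong[OF assms(1), where f = "\<lambda>x. \<Sum>b\<in>Basis. (g x \<bullet> b) *\<^sub>R F x b"])
  show "(\<Sum>b\<in>Basis. (g x \<bullet> b) *\<^sub>R F x b) = F x (g x)" if "x \<in> U" for x
    by (rule linear_Basis_expand[OF assms(2)[OF that], symmetric])
  show "ck_open k U (\<lambda>x. \<Sum>b\<in>Basis. (g x \<bullet> b) *\<^sub>R F x b)"
    by (intro ck_open_sum ck_open_bilinear[OF bounded_bilinear_scaleR] assms
        ck_open_linear_comp[OF bounded_linear_inner_left])
qed

text \<open>The chain rule produces a family of linear maps applied to a varying vector, exactly the
  shape of \<open>ck_open_apply_linear\<close>.\<close>

lemma ck_open_compose: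
  fixes f :: "'b::euclidean_space \<Rightarrow> 'c::euclidean_space"
    and g :: "'a::euclidean_space \<Rightarrow> 'b::euclidean_space"
  assumes U: "open U" and gUV: "g ` U \<subseteq> V"
  shows "ck_open k V f \<Longrightarrow> ck_open k U g \<Longrightarrow> ck_open k U (\<lambda>x. f (g x))"
proof (induction k arbitrary: f)
  case 0
  then show ?case using gUV by (auto intro: continuous_on_compose2)
next
  case (Suc k)
  have g: "ck_open k U g" using Suc.prems ck_open_Suc_imp by blast
  show ?case
  proof (rule ck_open_SucI[OF U])
    show "((\<lambda>x. f (g x)) has_derivative
        (\<lambda>v. frechet_derivative f (at (g x)) (frechet_derivative g (at x) v))) (at x)"
      if "x \<in> U" for x
      using gUV that by (intro has_derivative_compose[OF ck_open_SucD(1)[OF Suc.prems(2)]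
          ck_open_SucD(1)[OF Suc.prems(1)]]) auto
    fix v
    show "ck_open k U (\<lambda>x. frechet_derivative f (at (g x)) (frechet_derivative g (at x) v))"
    proof (rule ck_open_apply_linear[OF U, where F = "\<lambda>x. frechet_derivative f (at (g x))"])
      show "linear (frechet_derivative f (at (g x)))" if "x \<in> U" for x
        using that gUV Suc.prems(1) by (auto intro: linear_frechet_derivative)
      show "ck_open k U (\<lambda>x. frechet_derivative f (at (g x)) b)" for b
        using Suc.IH[of "\<lambda>x. frechet_derivative f (at x) b"] g Suc.prems(1) by simp
      show "ck_open k U (\<lambda>x. frechet_derivative g (at x) v)"
        using Suc.prems by simp
    qed
  qed
qed

section \<open>Closure rules for smooth maps\<close>

lemma smooth_open_imp_ck: "smooth_open U f \<Longrightarrow> ck_open k U f"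
  by (simp add: smooth_open_def)

lemma smooth_open_continuous: "smooth_open U f \<Longrightarrow> continuous_on U f"
  using ck_open_continuous smooth_open_imp_ck by blast

lemma smooth_open_cong:
  "open U \<Longrightarrow> (\<And>x. x \<in> U \<Longrightarrow> f x = g x) \<Longrightarrow> smooth_open U f \<Longrightarrow> smooth_open U g"
  unfolding smooth_open_def using ck_open_cong by blast

lemma smooth_open_subset: "smooth_open U f \<Longrightarrow> V \<subseteq> U \<Longrightarrow> smooth_open V f"
  unfolding smooth_open_def using ck_open_subset by blast

lemma smooth_open_const: "smooth_open U (\<lambda>x. c)"
  unfolding smooth_open_def using ck_open_const by blast

lemma smooth_open_bounded_linear: "bounded_linear T \<Longrightarrow> open U \<Longrightarrow> smooth_open U T"
  unfolding smooth_open_def using ck_open_bounded_linear by blast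

lemma smooth_open_ident: "open U \<Longrightarrow> smooth_open U (\<lambda>x. x)"
  by (rule smooth_open_bounded_linear[OF bounded_linear_ident])

lemma smooth_open_linear_comp:
  "bounded_linear T \<Longrightarrow> open U \<Longrightarrow> smooth_open U f \<Longrightarrow> smooth_open U (\<lambda>x. T (f x))"
  unfolding smooth_open_def using ck_open_linear_comp by blast

lemma smooth_open_add:
  "open U \<Longrightarrow> smooth_open U f \<Longrightarrow> smooth_open U g \<Longrightarrow> smooth_open U (\<lambda>x. f x + g x)"
  unfolding smooth_open_def using ck_open_add by blast

lemma smooth_open_diff:
  "open U \<Longrightarrow> smooth_open U f \<Longrightarrow> smooth_open U g \<Longrightarrow> smooth_open U (\<lambda>x. f x - g x)"
  using smooth_open_add[of U f "\<lambda>x. - g x"]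
    smooth_open_linear_comp[OF bounded_linear_minus[OF bounded_linear_ident], of U g] by simp

lemma smooth_open_sum:
  "open U \<Longrightarrow> (\<And>i. i \<in> I \<Longrightarrow> smooth_open U (f i)) \<Longrightarrow> smooth_open U (\<lambda>x. \<Sum>i\<in>I. f i x)"
  unfolding smooth_open_def by (intro allI ck_open_sum) auto

lemma smooth_open_bilinear:
  "bounded_bilinear h \<Longrightarrow> open U \<Longrightarrow> smooth_open U f \<Longrightarrow> smooth_open U g
    \<Longrightarrow> smooth_open U (\<lambda>x. h (f x) (g x))"
  unfolding smooth_open_def using ck_open_bilinear by blast

lemmas smooth_open_scaleR = smooth_open_bilinear[OF bounded_bilinear_scaleR]
lemmas smooth_open_inner = smooth_open_bilinear[OF bounded_bilinear_inner]

lemma smooth_open_Pair: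
  fixes f :: "'a::euclidean_space \<Rightarrow> 'b::euclidean_space"
    and g :: "'a \<Rightarrow> 'c::euclidean_space"
  assumes "open U" "smooth_open U f" "smooth_open U g"
  shows "smooth_open U (\<lambda>x. (f x, g x))"
proof -
  have "bounded_linear (\<lambda>y. (y, 0) :: 'b \<times> 'c)" "bounded_linear (\<lambda>z. (0, z) :: 'b \<times> 'c)"
    by (auto intro!: bounded_linear_Pair bounded_linear_ident bounded_linear_zero)
  from smooth_open_add[OF assms(1) smooth_open_linear_comp[OF this(1) assms(1,2)]
      smooth_open_linear_comp[OF this(2) assms(1,3)]]
  show ?thesis by simp
qed

lemmas smooth_open_fst = smooth_open_linear_comp[OF bounded_linear_fst]
lemmas smooth_open_snd = smooth_open_linear_comp[OF bounded_linear_snd]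

lemma smooth_open_apply_linear:
  fixes F :: "'a::euclidean_space \<Rightarrow> 'b::euclidean_space \<Rightarrow> 'c::euclidean_space"
  assumes "open U" "\<And>x. x \<in> U \<Longrightarrow> linear (F x)" "\<And>b. smooth_open U (\<lambda>x. F x b)"
    and "smooth_open U g"
  shows "smooth_open U (\<lambda>x. F x (g x))"
  using assms unfolding smooth_open_def by (intro allI ck_open_apply_linear[where F = F and g = g]) auto

lemma smooth_open_compose:
  fixes f :: "'b::euclidean_space \<Rightarrow> 'c::euclidean_space"
    and g :: "'a::euclidean_space \<Rightarrow> 'b::euclidean_space"
  assumes "open U" "smooth_open U g" "smooth_open V f" "\<And>x. x \<in> U \<Longrightarrow> g x \<in> V"
  shows "smooth_open U (\<lambda>x. f (g x))"
  using assms unfolding smooth_open_def by (intro allI ck_open_compose[of U g V _ f]) auto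

lemma smooth_open_has_derivative:
  "smooth_open U f \<Longrightarrow> x \<in> U \<Longrightarrow> (f has_derivative frechet_derivative f (at x)) (at x)"
  using ck_open_SucD(1)[OF smooth_open_imp_ck] by blast

lemma smooth_open_linear:
  "smooth_open U f \<Longrightarrow> x \<in> U \<Longrightarrow> linear (frechet_derivative f (at x))"
  using smooth_open_has_derivative has_derivative_linear by blast

lemma smooth_open_deriv: "smooth_open U f \<Longrightarrow> smooth_open U (\<lambda>x. frechet_derivative f (at x) v)"
  unfolding smooth_open_def using ck_open_SucD(2) by blast

lemma smooth_open_deriv_apply:
  fixes f :: "'b::euclidean_space \<Rightarrow> 'c::euclidean_space"
    and g h :: "'a::euclidean_space \<Rightarrow> 'b"
  assumes "open U" "smooth_open V f" "smooth_open U g" "smooth_open U h"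
    and "\<And>x. x \<in> U \<Longrightarrow> g x \<in> V"
  shows "smooth_open U (\<lambda>x. frechet_derivative f (at (g x)) (h x))"
proof (rule smooth_open_apply_linear[OF assms(1) _ _ assms(4),
      where F = "\<lambda>x. frechet_derivative f (at (g x))"])
  show "linear (frechet_derivative f (at (g x)))" if "x \<in> U" for x
    by (rule smooth_open_linear[OF assms(2) assms(5)[OF that]])
  show "smooth_open U (\<lambda>x. frechet_derivative f (at (g x)) b)" for b
    by (rule smooth_open_compose[OF assms(1,3) smooth_open_deriv[OF assms(2)] assms(5)])
qed

section \<open>Derivatives along curves and of families of linear operators\<close>

lemma smooth_curve_vector_derivative:
  fixes f :: "'a::euclidean_space \<Rightarrow> 'b::euclidean_space"
  assumes "(c has_vector_derivative v) (at t)" "(f has_derivative F) (at (c t))"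
  shows "((\<lambda>s. f (c s)) has_vector_derivative F v) (at t)"
  using has_derivative_compose[OF assms(1)[unfolded has_vector_derivative_def] assms(2)]
    linear_scale[OF has_derivative_linear[OF assms(2)]]
  by (simp add: has_vector_derivative_def)

text \<open>Additivity and homogeneity in the argument pass to the derivative because derivatives
  are unique.\<close>

lemma linear_family_derivative:
  fixes F :: "'a::euclidean_space \<Rightarrow> 'b::euclidean_space \<Rightarrow> 'c::euclidean_space"
  assumes U: "open U" "x \<in> U" and lin: "\<And>y. y \<in> U \<Longrightarrow> linear (F y)"
    and der: "\<And>z. ((\<lambda>y. F y z) has_derivative F' z) (at x)"
  shows "linear (\<lambda>z. F' z v)"
proof (rule linearI)
  have "((\<lambda>y. F y (a + b)) has_derivative (\<lambda>v. F' a v + F' b v)) (at x)" for a b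
    by (rule has_derivative_transform_within_open[OF has_derivative_add[OF der der] U])
      (simp add: lin linear_add)
  then show "F' (a + b) v = F' a v + F' b v" for a b
    using has_derivative_unique[OF der[of "a + b"]] by metis
  have "((\<lambda>y. F y (r *\<^sub>R a)) has_derivative (\<lambda>v. r *\<^sub>R F' a v)) (at x)" for r a
    by (rule has_derivative_transform_within_open[OF has_derivative_scaleR_right[OF der] U])
      (simp add: lin linear_scale)
  then show "F' (r *\<^sub>R a) v = r *\<^sub>R F' a v" for r a
    using has_derivative_unique[OF der[of "r *\<^sub>R a"]] by metis
qed

text \<open>A product rule for evaluation: one term differentiates the operator, the other its
  argument. Linearity of \<open>F' z v\<close> in \<open>z\<close> reassembles the basis
  expansion.\<close>

lemma has_derivative_apply_linear:
  fixes F :: "'a::euclidean_space \<Rightarrow> 'b::euclidean_space \<Rightarrow> 'c::euclidean_space" and g :: "'a \<Rightarrow> 'b"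
  assumes U: "open U" "x \<in> U" and lin: "\<And>y. y \<in> U \<Longrightarrow> linear (F y)"
    and der: "\<And>z. ((\<lambda>y. F y z) has_derivative F' z) (at x)"
    and g: "(g has_derivative g') (at x)"
  shows "((\<lambda>y. F y (g y)) has_derivative (\<lambda>v. F' (g x) v + F x (g' v))) (at x)"
proof -
  have "((\<lambda>y. \<Sum>b\<in>Basis. (g y \<bullet> b) *\<^sub>R F y b) has_derivative
      (\<lambda>v. \<Sum>b\<in>Basis. (g x \<bullet> b) *\<^sub>R F' b v + (g' v \<bullet> b) *\<^sub>R F x b)) (at x)"
    by (intro has_derivative_sum has_derivative_scaleR has_derivative_inner_left der g)
  moreover have "(\<Sum>b\<in>Basis. (g x \<bullet> b) *\<^sub>R F' b v + (g' v \<bullet> b) *\<^sub>R F x b) = F' (g x) v + F x (g' v)" for v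
  proof -
    have "F' (g x) v = (\<Sum>b\<in>Basis. (g x \<bullet> b) *\<^sub>R F' b v)"
      by (rule linear_Basis_expand[where f = "\<lambda>z. F' z v"]) (rule linear_family_derivative[OF U lin der])
    moreover have "F x (g' v) = (\<Sum>b\<in>Basis. (g' v \<bullet> b) *\<^sub>R F x b)"
      by (rule linear_Basis_expand[OF lin[OF U(2)]])
    ultimately show ?thesis by (simp only: sum.distrib)
  qed
  ultimately have "((\<lambda>y. \<Sum>b\<in>Basis. (g y \<bullet> b) *\<^sub>R F y b) has_derivative
      (\<lambda>v. F' (g x) v + F x (g' v))) (at x)" by simp
  then show ?thesis
    by (rule has_derivative_transform_within_open[OF _ U])
      (rule linear_Basis_expand[OF lin, symmetric])
qed

text \<open>The resolvent identity \<open>C y - C x = C y (B x - B y) C x\<close> and the bound on \<open>C\<close> give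
  \<open>D(C w)(v) = - C (DB(v) (C w))\<close>, to which the induction on the order applies.\<close>

lemma inverse_has_derivative:
  fixes B C :: "'a::euclidean_space \<Rightarrow> 'b::euclidean_space \<Rightarrow> 'b"
  assumes U: "open U" "x \<in> U"
    and lin: "\<And>y. y \<in> U \<Longrightarrow> linear (B y)" "\<And>y. y \<in> U \<Longrightarrow> linear (C y)"
    and inv: "\<And>y w. y \<in> U \<Longrightarrow> C y (B y w) = w" "\<And>y w. y \<in> U \<Longrightarrow> B y (C y w) = w"
    and bd: "\<And>y w. y \<in> U \<Longrightarrow> norm (C y w) \<le> norm w"
    and der: "\<And>w. ((\<lambda>y. B y w) has_derivative B' w) (at x)"
  shows "((\<lambda>y. C y w) has_derivative (\<lambda>v. - C x (B' (C x w) v))) (at x)"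
proof -
  let ?f = "C x w"
  \<comment> \<open>The bound on \<open>C y\<close> is uniform in \<open>y\<close>, so continuity of
    \<open>B\<close> at the single vector \<open>C x z\<close> suffices.\<close>
  have cont: "((\<lambda>y. C y z) \<longlongrightarrow> C x z) (at x)" for z
  proof -
    have "((\<lambda>y. norm (B x (C x z) - B y (C x z))) \<longlongrightarrow> 0) (at x)"
      using has_derivative_continuous[OF der[of "C x z"]]
      by (intro tendsto_norm_zero) (auto simp: continuous_within intro!: tendsto_eq_intros)
    moreover have "\<forall>\<^sub>F y in at x. norm (C y z - C x z) \<le> norm (B x (C x z) - B y (C x z))"
      using eventually_at_in_open'[OF U]
    proof eventually_elim
      case (elim y)
      have "C y z - C x z = C y (B x (C x z) - B y (C x z))"
        using inv elim U lin by (simp add: linear_diff)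
      then show ?case using bd elim by metis
    qed
    ultimately have "((\<lambda>y. C y z - C x z) \<longlongrightarrow> 0) (at x)"
      by (rule Lim_null_comparison[rotated])
    then show ?thesis by (rule LIM_zero_cancel)
  qed
  have linB': "linear (B' z)" for z using der has_derivative_linear by blast
  have linx: "linear (C x)" using lin U by blast
  \<comment> \<open>\<open>e\<close> is the normalized remainder of \<open>B\<close> at
    \<open>C x w\<close>, and \<open>r\<close> bounds, through finitely many basis vectors, the
    error of replacing \<open>C y\<close> by \<open>C x\<close>. The first tends to zero by
    differentiability of \<open>B\<close>, the second by the continuity just shown.\<close>
  define e where "e y = (1 / norm (y - x)) *\<^sub>R (B y ?f - B x ?f - B' ?f (y - x))" for y
  define r where "r y = (\<Sum>b\<in>Basis. norm (C x (B' ?f b) - C y (B' ?f b)))" for y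
  have e: "((\<lambda>y. norm (e y)) \<longlongrightarrow> 0) (at x)"
    using der[of ?f] unfolding e_def has_derivative_def
    by (intro tendsto_norm_zero) (simp add: algebra_simps divide_inverse)
  have r: "(r \<longlongrightarrow> 0) (at x)"
    unfolding r_def by (rule tendsto_null_sum)
      (auto intro!: tendsto_norm_zero tendsto_eq_intros cont)
  have main: "\<forall>\<^sub>F y in at x. norm ((1 / norm (y - x)) *\<^sub>R (C y w - (C x w + (- C x (B' ?f (y - x)))))) \<le> norm (e y) + r y"
    using eventually_at_in_open[OF U]
  proof eventually_elim
    case (elim y)
    then have y: "y \<in> U" "y \<noteq> x" by auto
    let ?h = "y - x"
    have liny: "linear (C y)" using lin y by blast
    have "C y w - ?f = C y (B x ?f - B y ?f)"
      using inv y U liny by (simp add: linear_diff)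
    also have "\<dots> = - C y (norm ?h *\<^sub>R e y) - C y (B' ?f ?h)"
    proof -
      have "B x ?f - B y ?f = - (norm ?h *\<^sub>R e y) - B' ?f ?h" using y by (simp add: e_def)
      then show ?thesis using liny by (simp add: linear_diff linear_neg)
    qed
    finally have "C y w - (C x w + (- C x (B' ?f ?h))) =
        - norm ?h *\<^sub>R C y (e y) + (C x (B' ?f ?h) - C y (B' ?f ?h))"
      using liny by (simp add: linear_scale algebra_simps)
    then have "norm (C y w - (C x w + (- C x (B' ?f ?h)))) \<le>
        norm ?h * norm (C y (e y)) + norm (C x (B' ?f ?h) - C y (B' ?f ?h))"
      by (metis norm_triangle_ineq norm_scaleR abs_minus_cancel abs_norm_cancel)
    also have "norm (C x (B' ?f ?h) - C y (B' ?f ?h)) \<le> norm ?h * r y"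
    proof -
      have "linear (\<lambda>v. C x (B' ?f v) - C y (B' ?f v))"
        using linear_compose_sub[OF linear_compose[OF linB' linx] linear_compose[OF linB' liny]]
        by (simp add: o_def)
      then have "C x (B' ?f ?h) - C y (B' ?f ?h) =
          (\<Sum>b\<in>Basis. (?h \<bullet> b) *\<^sub>R (C x (B' ?f b) - C y (B' ?f b)))"
        by (rule linear_Basis_expand)
      also have "norm \<dots> \<le> (\<Sum>b\<in>Basis. norm ?h * norm (C x (B' ?f b) - C y (B' ?f b)))"
        by (intro sum_norm_le) (auto intro!: mult_right_mono Basis_le_norm)
      finally show ?thesis by (simp add: r_def sum_distrib_left)
    qed
    also have "norm (C y (e y)) \<le> norm (e y)" using bd y by blast
    finally have "norm (C y w - (C x w + (- C x (B' ?f ?h)))) \<le> norm ?h * (norm (e y) + r y)"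
      by (simp add: distrib_left mult_left_mono)
    then show ?case
      unfolding norm_scaleR using y by (simp add: pos_divide_le_eq mult.commute)
  qed
  have "((\<lambda>y. (1 / norm (y - x)) *\<^sub>R (C y w - (C x w + (- C x (B' ?f (y - x)))))) \<longlongrightarrow> 0) (at x)"
    by (rule Lim_null_comparison[OF main]) (use tendsto_add[OF e r] in simp)
  moreover have "bounded_linear (\<lambda>v. - C x (B' (C x w) v))"
    by (intro bounded_linear_minus linear_conv_bounded_linear[THEN iffD1])
      (use linear_compose[OF linB' linx] in \<open>simp add: o_def\<close>)
  ultimately show ?thesis
    unfolding has_derivative_within by simp
qed

lemma smooth_open_inverse:
  fixes B C :: "'a::euclidean_space \<Rightarrow> 'b::euclidean_space \<Rightarrow> 'b"
  assumes U: "open U"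
    and lin: "\<And>y. y \<in> U \<Longrightarrow> linear (B y)" "\<And>y. y \<in> U \<Longrightarrow> linear (C y)"
    and inv: "\<And>y w. y \<in> U \<Longrightarrow> C y (B y w) = w" "\<And>y w. y \<in> U \<Longrightarrow> B y (C y w) = w"
    and bd: "\<And>y w. y \<in> U \<Longrightarrow> norm (C y w) \<le> norm w"
    and sm: "\<And>w. smooth_open U (\<lambda>y. B y w)"
  shows "smooth_open U (\<lambda>y. C y w)"
proof -
  define B' where "B' x z v = frechet_derivative (\<lambda>y. B y z) (at x) v" for x z v
  have derB: "((\<lambda>y. B y z) has_derivative B' x z) (at x)" if "x \<in> U" for x z
    using smooth_open_has_derivative[OF sm that] by (simp add: B'_def[abs_def])
  have der: "((\<lambda>y. C y w) has_derivative (\<lambda>v. - C x (B' x (C x w) v))) (at x)" if x: "x \<in> U" for x w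
    using inverse_has_derivative[OF U x lin inv bd derB[OF x]] by simp
  have linB': "linear (\<lambda>z. B' x z v)" if "x \<in> U" for x v
    by (rule linear_family_derivative[OF U that lin(1) derB[OF that]])
  have "ck_open k U (\<lambda>y. C y w)" for k w
  \<comment> \<open>The vector must vary, since the derivative applies \<open>C x\<close> to other
    vectors, themselves depending on \<open>x\<close>.\<close>
  proof (induction k arbitrary: w)
    case 0
    show ?case
      using der U by (auto simp: continuous_on_eq_continuous_at intro!: has_derivative_continuous)
  next
    case (Suc k)
    show ?case
    proof (rule ck_open_SucI[OF U der])
      fix v
      have D: "ck_open k U (\<lambda>x. B' x (C x w) v)"
        by (rule ck_open_apply_linear[OF U linB' _ Suc.IH])
          (use smooth_open_deriv[OF sm] in \<open>auto simp: smooth_open_def B'_def\<close>)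
      have "ck_open k U (\<lambda>x. C x (B' x (C x w) v))"
        by (rule ck_open_apply_linear[OF U lin(2) Suc.IH D])
      then show "ck_open k U (\<lambda>x. - C x (B' x (C x w) v))"
        by (rule ck_open_linear_comp[OF bounded_linear_minus[OF bounded_linear_ident] U])
    qed
  qed
  then show ?thesis by (simp add: smooth_open_def)
qed

section \<open>Orthogonal projections\<close>

lemma orth_proj_ex1:
  fixes S :: "'a::euclidean_space set"
  assumes S: "subspace S"
  shows "\<exists>!p. p \<in> S \<and> v - p \<in> orthogonal_comp S"
proof
  obtain y z where "y \<in> span S" "\<And>w. w \<in> span S \<Longrightarrow> orthogonal z w" "v = y + z"
    using orthogonal_subspace_decomp_exists[of S v] by blast
  then have "y \<in> S \<and> v - y \<in> orthogonal_comp S"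
    using S by (auto simp: orthogonal_comp_def span_eq_iff[THEN iffD2] orthogonal_commute)
  then show "(SOME p. p \<in> S \<and> v - p \<in> orthogonal_comp S) \<in> S \<and>
      v - (SOME p. p \<in> S \<and> v - p \<in> orthogonal_comp S) \<in> orthogonal_comp S"
    by (rule someI)
next
  fix p
  let ?q = "SOME p. p \<in> S \<and> v - p \<in> orthogonal_comp S"
  assume p: "p \<in> S \<and> v - p \<in> orthogonal_comp S"
  then have q: "?q \<in> S \<and> v - ?q \<in> orthogonal_comp S" by (rule someI)
  have "(v - ?q) - (v - p) \<in> orthogonal_comp S"
    using p q subspace_orthogonal_comp subspace_diff by blast
  moreover have "p - ?q \<in> S" using p q S subspace_diff by blast
  ultimately have "orthogonal (p - ?q) (p - ?q)"
    by (auto simp: orthogonal_comp_def)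
  then show "p = ?q" by (simp add: orthogonal_self)
qed

lemma orth_proj:
  fixes S :: "'a::euclidean_space set"
  assumes S: "subspace S"
  shows orth_proj_mem: "orth_proj S v \<in> S"
    and orth_proj_perp: "v - orth_proj S v \<in> orthogonal_comp S"
  using theI'[OF orth_proj_ex1[OF S, of v]] by (auto simp: orth_proj_def)

lemma orth_proj_eqI:
  fixes S :: "'a::euclidean_space set"
  assumes S: "subspace S" and "p \<in> S" "v - p \<in> orthogonal_comp S"
  shows "orth_proj S v = p"
  using the1_equality[OF orth_proj_ex1[OF S, of v], of p] assms by (simp add: orth_proj_def)

lemma orth_proj_ident:
  fixes S :: "'a::euclidean_space set"
  assumes S: "subspace S" and "v \<in> S"
  shows "orth_proj S v = v"
  using assms by (intro orth_proj_eqI) (auto simp: subspace_orthogonal_comp subspace_0)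

lemma linear_orth_proj:
  fixes S :: "'a::euclidean_space set"
  assumes S: "subspace S"
  shows "linear (orth_proj S)"
proof (rule linearI)
  note 1 = orth_proj_mem[OF S] and 2 = orth_proj_perp[OF S]
  note 3 = subspace_add[OF S] subspace_scale[OF S]
    subspace_add[OF subspace_orthogonal_comp] subspace_scale[OF subspace_orthogonal_comp]
  show "orth_proj S (v + w) = orth_proj S v + orth_proj S w" for v w
    by (rule orth_proj_eqI[OF S]) (use 3(1)[OF 1 1] 3(3)[OF 2 2] in \<open>auto simp: add_diff_add\<close>)
  show "orth_proj S (r *\<^sub>R v) = r *\<^sub>R orth_proj S v" for r v
    by (rule orth_proj_eqI[OF S])
      (use 3(2)[OF 1] 3(4)[OF 2] in \<open>auto simp: scaleR_right_diff_distrib[symmetric]\<close>)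
qed

lemma orth_proj_inner:
  fixes S :: "'a::euclidean_space set"
  assumes S: "subspace S" and w: "w \<in> S"
  shows "orth_proj S v \<bullet> w = v \<bullet> w"
  using orth_proj_perp[OF S, of v] w
  by (auto simp: orthogonal_comp_def orthogonal_def inner_diff_right inner_commute)

lemma orth_proj_adjoint:
  fixes S :: "'a::euclidean_space set"
  assumes S: "subspace S"
  shows "orth_proj S v \<bullet> w = v \<bullet> orth_proj S w"
  using orth_proj_inner[OF S orth_proj_mem[OF S], of v w] orth_proj_inner[OF S orth_proj_mem[OF S], of w v]
  by (simp add: inner_commute)

lemma orth_proj_zero_iff:
  fixes S :: "'a::euclidean_space set"
  assumes S: "subspace S"
  shows "orth_proj S v = 0 \<longleftrightarrow> v \<in> orthogonal_comp S"
  using orth_proj_perp[OF S, of v] orth_proj_eqI[OF S, of 0 v] subspace_0[OF S] by auto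

lemma orth_proj_orthogonal_comp:
  fixes S :: "'a::euclidean_space set"
  assumes S: "subspace S"
  shows "orth_proj (orthogonal_comp S) v = v - orth_proj S v"
  using orth_proj_mem[OF S, of v] orthogonal_comp_subset[of S]
  by (intro orth_proj_eqI[OF subspace_orthogonal_comp] orth_proj_perp[OF S]) auto

text \<open>The orthogonal projection onto the range of an idempotent \<open>R\<close> is \<open>R (R + R\<^sup>T - I)\<^sup>-\<^sup>1\<close>;
  the middle operator \<open>B\<close> is expanding because \<open>B\<^sup>2 = I + (R - R\<^sup>T) (R - R\<^sup>T)\<^sup>T\<close>.\<close>

lemma idempotent_expanding:
  fixes R :: "'a::euclidean_space \<Rightarrow> 'a"
  assumes lin: "linear R" and idem: "\<And>z. R (R z) = R z"
  shows "norm z \<le> norm (R z + adjoint R z - z)"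
proof -
  let ?a = "R z" and ?b = "adjoint R z"
  have ab: "?a \<bullet> ?b = ?a \<bullet> z"
    using adjoint_works[OF lin, of "R z" z] idem by (simp add: inner_commute)
  have bz: "?b \<bullet> z = ?a \<bullet> z"
    using adjoint_works[OF lin, of z z] by (simp add: inner_commute)
  have "(norm (?a + ?b - z))\<^sup>2 = (norm z)\<^sup>2 + (norm (?a - ?b))\<^sup>2"
    using ab bz unfolding power2_norm_eq_inner
    by (simp add: inner_add_left inner_add_right inner_diff_left inner_diff_right inner_commute)
  then have "(norm z)\<^sup>2 \<le> (norm (?a + ?b - z))\<^sup>2" by simp
  then show ?thesis by (rule power2_le_imp_le) simp
qed

text \<open>The difference of argument and value is \<open>adjoint R z - z\<close>. It is orthogonal
  to the range because \<open>R\<close> minus the identity vanishes there.\<close>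

lemma orth_proj_range_idempotent:
  fixes R :: "'a::euclidean_space \<Rightarrow> 'a"
  assumes lin: "linear R" and idem: "\<And>z. R (R z) = R z"
  shows "orth_proj (range R) (R z + adjoint R z - z) = R z"
proof (rule orth_proj_eqI)
  show "subspace (range R)" using linear_subspace_image[OF lin subspace_UNIV] .
  have "(adjoint R z - z) \<bullet> R y = 0" for y
    using adjoint_works[OF lin, of "R y" z] idem
    by (simp add: inner_diff_left inner_diff_right inner_commute)
  then show "R z + adjoint R z - z - R z \<in> orthogonal_comp (range R)"
    by (auto simp: orthogonal_comp_def orthogonal_def inner_commute)
qed simp

lemma smooth_open_orth_proj_range:
  fixes R :: "'a::euclidean_space \<Rightarrow> 'b::euclidean_space \<Rightarrow> 'b"
  assumes U: "open U"
    and lin: "\<And>x. x \<in> U \<Longrightarrow> linear (R x)" and idem: "\<And>x z. x \<in> U \<Longrightarrow> R x (R x z) = R x z"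
    and sm: "\<And>w. smooth_open U (\<lambda>x. R x w)"
  shows "smooth_open U (\<lambda>x. orth_proj (range (R x)) w)"
proof -
  define B where "B x z = R x z + adjoint (R x) z - z" for x z
  define C where "C x = inv (B x)" for x
  have linB: "linear (B x)" if "x \<in> U" for x
    unfolding B_def
    by (intro linear_compose_sub linear_compose_add lin adjoint_linear that linear_ident)
  have exp: "norm z \<le> norm (B x z)" if "x \<in> U" for x z
    using idempotent_expanding[OF lin idem, OF that that] by (simp add: B_def)
  have inj: "inj (B x)" if "x \<in> U" for x
    using linear_injective_0[OF linB[OF that]] exp[OF that] by (metis norm_le_zero_iff norm_zero)
  have bij: "bij (B x)" if "x \<in> U" for x
    using linear_injective_imp_surjective[OF linB[OF that] inj[OF that]] inj[OF that]
    by (simp add: bij_def)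
  have C: "C x (B x z) = z" "B x (C x z) = z" if "x \<in> U" for x z
    using bij[OF that] by (simp_all add: C_def bij_is_inj bij_is_surj surj_f_inv_f)
  have linC: "linear (C x)" if "x \<in> U" for x
  proof (rule linearI)
    show "C x (y + z) = C x y + C x z" for y z
      by (metis C[OF that] linear_add[OF linB[OF that]])
    show "C x (a *\<^sub>R z) = a *\<^sub>R C x z" for a z
      by (metis C[OF that] linear_scale[OF linB[OF that]])
  qed
  \<comment> \<open>Expansion of \<open>B\<close> read backwards is the bound on the inverse that
    \<open>smooth_open_inverse\<close> asks for.\<close>
  have normC: "norm (C x z) \<le> norm z" if "x \<in> U" for x z
    using exp[OF that, of "C x z"] C(2)[OF that] by simp
  have smB: "smooth_open U (\<lambda>x. B x z)" for z
  proof -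
    \<comment> \<open>The coordinates of the adjoint are inner products with the vectors
      \<open>R x b\<close>, which makes its smoothness visible.\<close>
    have sum: "smooth_open U (\<lambda>x. \<Sum>b\<in>Basis. (z \<bullet> R x b) *\<^sub>R b)"
      by (intro smooth_open_sum smooth_open_scaleR smooth_open_inner smooth_open_const U sm)
    have eq: "(\<Sum>b\<in>Basis. (z \<bullet> R x b) *\<^sub>R b) = adjoint (R x) z" if "x \<in> U" for x
    proof -
      have "(\<Sum>b\<in>Basis. (z \<bullet> R x b) *\<^sub>R b) = (\<Sum>b\<in>Basis. (adjoint (R x) z \<bullet> b) *\<^sub>R b)"
        by (rule sum.cong) (simp_all add: adjoint_works[OF lin[OF that]] inner_commute)
      then show ?thesis by (simp only: euclidean_representation)
    qed
    have "smooth_open U (\<lambda>x. adjoint (R x) z)"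
      by (rule smooth_open_cong[OF U eq sum])
    then show ?thesis
      unfolding B_def by (intro smooth_open_diff smooth_open_add sm U smooth_open_const)
  qed
  have smC: "smooth_open U (\<lambda>x. C x w)"
    by (rule smooth_open_inverse[OF U linB linC C normC smB])
  have "smooth_open U (\<lambda>x. R x (C x w))"
    by (rule smooth_open_apply_linear[OF U lin sm smC])
  then show ?thesis
  proof (rule smooth_open_cong[OF U, rotated])
    show "R x (C x w) = orth_proj (range (R x)) w" if "x \<in> U" for x
      using orth_proj_range_idempotent[OF lin idem, OF that that, of "C x w"] C(2)[OF that, of w]
      by (simp add: B_def)
  qed
qed

section \<open>Tangent spaces and local retractions\<close>

lemma open_real_interval:
  assumes "open (T :: real set)" "0 \<in> T"
  obtains e where "0 < e" "{-e<..<e} \<subseteq> T"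
proof -
  obtain e where "0 < e" "ball 0 e \<subseteq> T" using assms open_contains_ball by metis
  then show ?thesis using that[of e] by (auto simp: ball_def dist_real_def subset_iff abs_less_iff)
qed

text \<open>Curves cut down to stay in a chart live on open preimages rather than symmetric
  intervals; this form accepts them directly.\<close>

lemma tangent_spaceI:
  assumes "open T" "0 \<in> T" "smooth_open T c" "\<And>t. t \<in> T \<Longrightarrow> c t \<in> M"
    and "c 0 = x" "(c has_vector_derivative v) (at 0)"
  shows "v \<in> tangent_space M x"
proof -
  obtain e where "0 < e" "{-e<..<e} \<subseteq> T" using open_real_interval assms(1,2) by blast
  then show ?thesis
    unfolding tangent_space_def using assms smooth_open_subset[OF assms(3)] by blast
qed

lemma tangent_spaceE:
  assumes "v \<in> tangent_space M x"
  obtains T c where "open T" "0 \<in> T" "smooth_open T c" "\<And>t. t \<in> T \<Longrightarrow> c t \<in> M"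
    "c 0 = x" "(c has_vector_derivative v) (at 0)"
proof -
  obtain c e where "0 < e" "smooth_open {-e<..<e} c" "c ` {-e<..<e} \<subseteq> M" "c 0 = x"
    "(c has_vector_derivative v) (at 0)"
    using assms unfolding tangent_space_def by blast
  then show ?thesis by (intro that[of "{-e<..<e}" c]) auto
qed

text \<open>Values are required to lie in \<open>U\<close> as well as in \<open>M\<close>, so that
  the derivative of \<open>r\<close> can be taken at \<open>r z\<close>.\<close>

definition local_retraction :: "'a::euclidean_space set \<Rightarrow> 'a set \<Rightarrow> ('a \<Rightarrow> 'a) \<Rightarrow> bool" where
  "local_retraction M U r \<longleftrightarrow>
     open U \<and> smooth_open U r \<and> (\<forall>z\<in>U. r z \<in> M \<inter> U) \<and> (\<forall>z\<in>M \<inter> U. r z = z)"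

text \<open>In a flattening chart \<open>M\<close> is a piece of the subspace \<open>S\<close>, and
  the orthogonal projection onto \<open>S\<close> is transported back.\<close>

lemma embedded_submanifold_local_retraction:
  fixes M :: "'a::euclidean_space set"
  assumes "embedded_submanifold n M" "p \<in> M"
  obtains U r where "p \<in> U" "local_retraction M U r"
proof -
  obtain U0 V \<phi> \<psi> and S :: "'a set" where
    *: "open U0" "p \<in> U0" "open V" "smooth_open U0 \<phi>" "smooth_open V \<psi>" "homeomorphism U0 V \<phi> \<psi>"
      "subspace S" "\<phi> ` (M \<inter> U0) = S \<inter> V"
    using bspec[OF assms(1)[unfolded embedded_submanifold_def] assms(2)] by (elim exE conjE) (rule that)
  note hom = homeomorphism_apply1[OF *(6)] homeomorphism_apply2[OF *(6)]
    homeomorphism_image1[OF *(6)] homeomorphism_image2[OF *(6)]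
  let ?\<pi> = "orth_proj S"
  \<comment> \<open>Cut down so that the projected point is still in the image of the chart.\<close>
  define U where "U = U0 \<inter> (\<lambda>x. ?\<pi> (\<phi> x)) -` V"
  define r where "r x = \<psi> (?\<pi> (\<phi> x))" for x
  have bl: "bounded_linear ?\<pi>"
    using linear_orth_proj[OF *(7)] by (simp add: linear_conv_bounded_linear)
  have sm: "smooth_open U0 (\<lambda>x. ?\<pi> (\<phi> x))"
    by (rule smooth_open_linear_comp[OF bl *(1,4)])
  have opU: "open U"
    unfolding U_def by (rule continuous_open_preimage[OF smooth_open_continuous[OF sm] *(1,3)])
  have r: "r x \<in> M \<inter> U0 \<and> \<phi> (r x) = ?\<pi> (\<phi> x)" if "x \<in> U" for x
  proof -
    have "?\<pi> (\<phi> x) \<in> S \<inter> V" using that orth_proj_mem[OF *(7)] by (auto simp: U_def)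
    then obtain y where y: "y \<in> M \<inter> U0" "\<phi> y = ?\<pi> (\<phi> x)" using *(8) by (metis imageE)
    then have "r x = y" unfolding r_def using hom(1)[of y] by auto
    with y show ?thesis by simp
  qed
  have "local_retraction M U r"
    unfolding local_retraction_def
  proof (intro conjI ballI)
    show "open U" by (rule opU)
    show "smooth_open U r" unfolding r_def
      by (rule smooth_open_compose[OF opU smooth_open_subset[OF sm] *(5)]) (auto simp: U_def)
    \<comment> \<open>\<open>\<phi> (r z)\<close> is already in \<open>S\<close>, so projecting it
      again changes nothing; this returns \<open>r z\<close> to \<open>U\<close>.\<close>
    show "r z \<in> M \<inter> U" if "z \<in> U" for z
      using r[OF that] that orth_proj_mem[OF *(7)] orth_proj_ident[OF *(7)] by (auto simp: U_def)
    show "r z = z" if "z \<in> M \<inter> U" for z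
    proof -
      have "\<phi> z \<in> S" using *(8) that by (auto simp: U_def)
      then show ?thesis using hom(1) that orth_proj_ident[OF *(7)] by (auto simp: r_def U_def)
    qed
  qed
  moreover have "p \<in> U"
  proof -
    have "\<phi> p \<in> S \<inter> V" using *(2,8) assms(2) by blast
    then show ?thesis using *(2) orth_proj_ident[OF *(7)] by (auto simp: U_def)
  qed
  ultimately show ?thesis using that by blast
qed

lemma local_retractionD:
  assumes "local_retraction M U r"
  shows "open U" "smooth_open U r" "\<And>z. z \<in> U \<Longrightarrow> r z \<in> M" "\<And>z. z \<in> U \<Longrightarrow> r z \<in> U"
    and "\<And>z. z \<in> M \<Longrightarrow> z \<in> U \<Longrightarrow> r z = z"
  using assms unfolding local_retraction_def by blast+

text \<open>Differentiate \<open>r (c t) = c t\<close> along a curve in \<open>M\<close>.\<close>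

lemma local_retraction_fixes_tangent:
  assumes r: "local_retraction M U r" and x: "x \<in> U" and v: "v \<in> tangent_space M x"
  shows "frechet_derivative r (at x) v = v"
proof -
  note r = local_retractionD[OF r]
  obtain T c where c: "open T" "0 \<in> T" "smooth_open T c" "\<And>t. t \<in> T \<Longrightarrow> c t \<in> M"
    "c 0 = x" "(c has_vector_derivative v) (at 0)"
    using tangent_spaceE[OF v] by blast
  have op: "open (T \<inter> c -` U)"
    by (rule continuous_open_preimage[OF smooth_open_continuous[OF c(3)] c(1) r(1)])
  have "((\<lambda>t. r (c t)) has_vector_derivative frechet_derivative r (at x) v) (at 0)"
    using smooth_curve_vector_derivative[OF c(6)] smooth_open_has_derivative[OF r(2) x] c(5) by blast
  then have "(c has_vector_derivative frechet_derivative r (at x) v) (at 0)"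
    by (rule has_vector_derivative_transform_within_open[OF _ op]) (use c r(5) x in auto)
  then show ?thesis using c(6) vector_derivative_at by metis
qed

text \<open>For the inclusion of the range, the retracted line
  \<open>\<lambda>t. r (x + t *\<^sub>R w)\<close> is a curve in \<open>M\<close> with the required
  velocity.\<close>

lemma tangent_space_eq_range:
  assumes r: "local_retraction M U r" and x: "x \<in> U" "x \<in> M"
  shows "tangent_space M x = range (frechet_derivative r (at x))"
proof
  show "tangent_space M x \<subseteq> range (frechet_derivative r (at x))"
    using local_retraction_fixes_tangent[OF r x(1)] by (metis rangeI subsetI)
  note r = local_retractionD[OF r]
  show "range (frechet_derivative r (at x)) \<subseteq> tangent_space M x"
  proof clarify
    fix w
    have sm: "smooth_open UNIV (\<lambda>t::real. x + t *\<^sub>R w)"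
      by (intro smooth_open_add smooth_open_scaleR smooth_open_const smooth_open_ident open_UNIV)
    have op: "open ((\<lambda>t::real. x + t *\<^sub>R w) -` U)"
      using continuous_open_preimage[OF smooth_open_continuous[OF sm] open_UNIV r(1)] by simp
    show "frechet_derivative r (at x) w \<in> tangent_space M x"
    proof (rule tangent_spaceI[OF op, where c = "\<lambda>t. r (x + t *\<^sub>R w)"])
      show "smooth_open ((\<lambda>t. x + t *\<^sub>R w) -` U) (\<lambda>t. r (x + t *\<^sub>R w))"
        by (rule smooth_open_compose[OF op smooth_open_subset[OF sm] r(2)]) auto
      have "((\<lambda>t. x + t *\<^sub>R w) has_vector_derivative w) (at 0)"
        by (auto intro!: derivative_eq_intros)
      then show "((\<lambda>t. r (x + t *\<^sub>R w)) has_vector_derivative frechet_derivative r (at x) w) (at 0)"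
        by (rule smooth_curve_vector_derivative) (use smooth_open_has_derivative[OF r(2) x(1)] in simp)
    qed (use x r in auto)
  qed
qed

lemma subspace_tangent_space:
  assumes "embedded_submanifold n M" "x \<in> M"
  shows "subspace (tangent_space M x)"
proof -
  obtain U r where r: "x \<in> U" "local_retraction M U r"
    using embedded_submanifold_local_retraction[OF assms] by blast
  show ?thesis
    unfolding tangent_space_eq_range[OF r(2,1) assms(2)]
    using linear_subspace_image[OF smooth_open_linear[OF local_retractionD(2)[OF r(2)] r(1)] subspace_UNIV] .
qed

text \<open>Off \<open>M\<close> the derivative of \<open>r\<close> need not be idempotent, so the projections are extended
  from \<open>M\<close> to \<open>U\<close> by precomposition with \<open>r\<close>.\<close>

lemma smooth_open_tangent_proj:
  assumes r: "local_retraction M U r"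
  shows "smooth_open U (\<lambda>z. orth_proj (tangent_space M (r z)) w)"
proof -
  note r' = local_retractionD[OF r]
  define R where "R z = frechet_derivative r (at (r z))" for z
  have eq: "tangent_space M (r z) = range (R z)" if "z \<in> U" for z
    using tangent_space_eq_range[OF r] r' that by (simp add: R_def)
  have "smooth_open U (\<lambda>z. orth_proj (range (R z)) w)"
  proof (rule smooth_open_orth_proj_range[OF r'(1)])
    show "linear (R z)" if "z \<in> U" for z
      unfolding R_def by (rule smooth_open_linear[OF r'(2) r'(4)[OF that]])
    show "R z (R z y) = R z y" if "z \<in> U" for z y
      using local_retraction_fixes_tangent[OF r r'(4)[OF that], of "R z y"] eq[OF that]
      by (simp add: R_def)
    show "smooth_open U (\<lambda>z. R z y)" for y
      unfolding R_def by (rule smooth_open_compose[OF r'(1,2) smooth_open_deriv[OF r'(2)] r'(4)])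
  qed
  then show ?thesis
    by (rule smooth_open_cong[OF r'(1), rotated]) (simp add: eq)
qed

section \<open>Symmetry of second derivatives\<close>

lemma smooth_open_line_derivative:
  fixes f :: "'a::euclidean_space \<Rightarrow> 'b::euclidean_space"
  assumes "smooth_open U f" "y + s *\<^sub>R v \<in> U"
  shows "((\<lambda>s. f (y + s *\<^sub>R v)) has_vector_derivative frechet_derivative f (at (y + s *\<^sub>R v)) v) (at s)"
proof -
  have "((\<lambda>s. y + s *\<^sub>R v) has_vector_derivative v) (at s)"
    by (auto intro!: derivative_eq_intros)
  then show ?thesis
    by (rule smooth_curve_vector_derivative[where f = f]) (rule smooth_open_has_derivative[OF assms])
qed

text \<open>Two applications of the mean value theorem: first in direction \<open>v\<close> to a
  difference of values, then in direction \<open>w\<close> to the derivative obtained.\<close>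

lemma second_difference_mvt:
  fixes f :: "'a::euclidean_space \<Rightarrow> real"
  assumes sm: "smooth_open U f" and h: "0 < h"
    and U: "\<And>s t. 0 \<le> s \<Longrightarrow> s \<le> h \<Longrightarrow> 0 \<le> t \<Longrightarrow> t \<le> h \<Longrightarrow> x + s *\<^sub>R v + t *\<^sub>R w \<in> U"
  obtains s t where "0 < s" "s < h" "0 < t" "t < h"
    "f (x + h *\<^sub>R v + h *\<^sub>R w) - f (x + h *\<^sub>R v) - f (x + h *\<^sub>R w) + f x =
      h * h * frechet_derivative (\<lambda>z. frechet_derivative f (at z) v) (at (x + s *\<^sub>R v + t *\<^sub>R w)) w"
proof -
  let ?D = "\<lambda>z. frechet_derivative f (at z) v"
  define g where "g s = f (x + s *\<^sub>R v + h *\<^sub>R w) - f (x + s *\<^sub>R v)" for s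
  have "DERIV g s :> ?D (x + s *\<^sub>R v + h *\<^sub>R w) - ?D (x + s *\<^sub>R v)" if "0 \<le> s" "s \<le> h" for s
  proof -
    have "((\<lambda>s. f ((x + h *\<^sub>R w) + s *\<^sub>R v)) has_vector_derivative ?D ((x + h *\<^sub>R w) + s *\<^sub>R v)) (at s)"
      by (rule smooth_open_line_derivative[OF sm]) (use U[of s h] that h in \<open>simp add: algebra_simps\<close>)
    moreover have "((\<lambda>s. f (x + s *\<^sub>R v)) has_vector_derivative ?D (x + s *\<^sub>R v)) (at s)"
      by (rule smooth_open_line_derivative[OF sm]) (use U[of s 0] that h in simp)
    ultimately show ?thesis
      unfolding g_def has_real_derivative_iff_has_vector_derivative
      by (intro has_vector_derivative_diff) (simp_all add: algebra_simps)
  qed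
  then obtain s where s: "0 < s" "s < h" "g h - g 0 = (h - 0) * (?D (x + s *\<^sub>R v + h *\<^sub>R w) - ?D (x + s *\<^sub>R v))"
    using MVT2[OF h, of g "\<lambda>s. ?D (x + s *\<^sub>R v + h *\<^sub>R w) - ?D (x + s *\<^sub>R v)"] by blast
  have "DERIV (\<lambda>t. ?D ((x + s *\<^sub>R v) + t *\<^sub>R w)) t :> frechet_derivative ?D (at ((x + s *\<^sub>R v) + t *\<^sub>R w)) w"
    if "0 \<le> t" "t \<le> h" for t
    unfolding has_real_derivative_iff_has_vector_derivative
    by (rule smooth_open_line_derivative[OF smooth_open_deriv[OF sm]]) (use U[of s t] that s in simp)
  then obtain t where t: "0 < t" "t < h"
    "?D ((x + s *\<^sub>R v) + h *\<^sub>R w) - ?D ((x + s *\<^sub>R v) + 0 *\<^sub>R w) =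
      (h - 0) * frechet_derivative ?D (at ((x + s *\<^sub>R v) + t *\<^sub>R w)) w"
    using MVT2[OF h, of "\<lambda>t. ?D ((x + s *\<^sub>R v) + t *\<^sub>R w)"
        "\<lambda>t. frechet_derivative ?D (at ((x + s *\<^sub>R v) + t *\<^sub>R w)) w"] by blast
  show ?thesis
    by (rule that[OF s(1,2) t(1,2)]) (use s(3) t(3) in \<open>simp add: g_def algebra_simps\<close>)
qed

text \<open>The second difference is unchanged when \<open>v\<close> and \<open>w\<close> are
  exchanged, so the two mixed derivatives agree at points arbitrarily near \<open>x\<close>;
  continuity does the rest.\<close>

lemma symmetric_second_derivative_real:
  fixes f :: "'a::euclidean_space \<Rightarrow> real"
  assumes U: "open U" "x \<in> U" and sm: "smooth_open U f"
  shows "frechet_derivative (\<lambda>z. frechet_derivative f (at z) v) (at x) w =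
    frechet_derivative (\<lambda>z. frechet_derivative f (at z) w) (at x) v" (is "?A v w x = ?A w v x")
proof (rule ccontr)
  assume ne: "?A v w x \<noteq> ?A w v x"
  \<comment> \<open>Half the supposed gap: two equal values, each strictly within \<open>e\<close>
    of its limit, keep the limits closer than the gap.\<close>
  define e where "e = \<bar>?A v w x - ?A w v x\<bar> / 2"
  have e: "0 < e" using ne by (simp add: e_def)
  have cont: "isCont (?A v w) x" for v w
    using smooth_open_continuous[OF smooth_open_deriv[OF smooth_open_deriv[OF sm]]] U
    by (simp add: continuous_on_eq_continuous_at)
  obtain d1 where d1: "0 < d1" "\<And>z. dist z x < d1 \<Longrightarrow> dist (?A v w z) (?A v w x) < e"
    using cont[of v w, unfolded continuous_at_eps_delta] e by blast
  obtain d2 where d2: "0 < d2" "\<And>z. dist z x < d2 \<Longrightarrow> dist (?A w v z) (?A w v x) < e"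
    using cont[of w v, unfolded continuous_at_eps_delta] e by blast
  obtain d3 where d3: "0 < d3" "ball x d3 \<subseteq> U" using U open_contains_ball by metis
  define d where "d = min d1 (min d2 d3)"
  have d: "0 < d" using d1 d2 d3 by (simp add: d_def)
  \<comment> \<open>Keeps the parallelogram with sides \<open>h *\<^sub>R v\<close> and
    \<open>h *\<^sub>R w\<close> within \<open>d\<close> of \<open>x\<close>; the summand 1 covers
    the case that both vectors vanish.\<close>
  define h where "h = d / (norm v + norm w + 1)"
  have pos: "0 < norm v + norm w + 1" by (simp add: add_nonneg_pos)
  have h: "0 < h" using d pos by (simp add: h_def)
  have near: "dist (x + s *\<^sub>R v + t *\<^sub>R w) x < d" if "0 \<le> s" "s \<le> h" "0 \<le> t" "t \<le> h" for s t
  proof -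
    have "dist (x + s *\<^sub>R v + t *\<^sub>R w) x \<le> norm (s *\<^sub>R v) + norm (t *\<^sub>R w)"
      unfolding dist_norm using norm_triangle_ineq[of "s *\<^sub>R v" "t *\<^sub>R w"] by (simp add: algebra_simps)
    also have "\<dots> \<le> h * norm v + h * norm w"
      using that by (intro add_mono) (auto intro: mult_right_mono)
    also have "\<dots> < h * (norm v + norm w + 1)" using h by (simp add: algebra_simps)
    also have "\<dots> = d" using pos by (simp add: h_def)
    finally show ?thesis .
  qed
  have inU: "x + s *\<^sub>R v + t *\<^sub>R w \<in> U" if "0 \<le> s" "s \<le> h" "0 \<le> t" "t \<le> h" for s t
    using near[OF that] d3(2) by (auto simp: d_def dist_commute)
  obtain s t where st: "0 < s" "s < h" "0 < t" "t < h"
    "f (x + h *\<^sub>R v + h *\<^sub>R w) - f (x + h *\<^sub>R v) - f (x + h *\<^sub>R w) + f x =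
      h * h * ?A v w (x + s *\<^sub>R v + t *\<^sub>R w)"
    by (rule second_difference_mvt[OF sm h, of x v w]) (auto intro: inU)
  obtain s' t' where st': "0 < s'" "s' < h" "0 < t'" "t' < h"
    "f (x + h *\<^sub>R w + h *\<^sub>R v) - f (x + h *\<^sub>R w) - f (x + h *\<^sub>R v) + f x =
      h * h * ?A w v (x + s' *\<^sub>R w + t' *\<^sub>R v)"
  proof (rule second_difference_mvt[OF sm h, of x w v])
    show "x + s *\<^sub>R w + t *\<^sub>R v \<in> U" if "0 \<le> s" "s \<le> h" "0 \<le> t" "t \<le> h" for s t
      using inU[of t s] that by (simp add: algebra_simps)
  qed
  have "h * h * ?A v w (x + s *\<^sub>R v + t *\<^sub>R w) = h * h * ?A w v (x + t' *\<^sub>R v + s' *\<^sub>R w)"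
    using st(5) st'(5) by (simp add: algebra_simps)
  then have "?A v w (x + s *\<^sub>R v + t *\<^sub>R w) = ?A w v (x + t' *\<^sub>R v + s' *\<^sub>R w)"
    using h by simp
  moreover have "dist (?A v w (x + s *\<^sub>R v + t *\<^sub>R w)) (?A v w x) < e"
    using near[of s t] st by (intro d1(2)) (simp add: d_def)
  moreover have "dist (?A w v (x + t' *\<^sub>R v + s' *\<^sub>R w)) (?A w v x) < e"
    using near[of t' s'] st' by (intro d2(2)) (simp add: d_def)
  ultimately have "dist (?A v w x) (?A w v x) < 2 * e"
    using dist_triangle3[of "?A v w x" "?A w v x" "?A v w (x + s *\<^sub>R v + t *\<^sub>R w)"] by simp
  then show False by (simp add: e_def dist_real_def)
qed

lemma frechet_derivative_inner_right:
  assumes "smooth_open U f" "x \<in> U"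
  shows "frechet_derivative (\<lambda>z. f z \<bullet> b) (at x) v = frechet_derivative f (at x) v \<bullet> b"
  using frechet_derivative_at[OF has_derivative_inner_left[OF smooth_open_has_derivative[OF assms]]] by metis

lemma symmetric_second_derivative:
  fixes f :: "'a::euclidean_space \<Rightarrow> 'b::euclidean_space"
  assumes U: "open U" "x \<in> U" and sm: "smooth_open U f"
  shows "frechet_derivative (\<lambda>z. frechet_derivative f (at z) v) (at x) w =
    frechet_derivative (\<lambda>z. frechet_derivative f (at z) w) (at x) v"
proof (rule euclidean_eqI)
  fix b :: 'b
  have smb: "smooth_open U (\<lambda>z. f z \<bullet> b)"
    by (rule smooth_open_linear_comp[OF bounded_linear_inner_left U(1) sm])
  have eq: "frechet_derivative (\<lambda>z. frechet_derivative (\<lambda>z. f z \<bullet> b) (at z) v) (at x) w =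
      frechet_derivative (\<lambda>z. frechet_derivative f (at z) v) (at x) w \<bullet> b" for v w
  proof -
    have "frechet_derivative (\<lambda>z. frechet_derivative (\<lambda>z. f z \<bullet> b) (at z) v) (at x) =
        frechet_derivative (\<lambda>z. frechet_derivative f (at z) v \<bullet> b) (at x)"
      by (rule frechet_derivative_transform_within_open[OF _ U])
        (use smooth_open_has_derivative[OF smooth_open_deriv[OF smb] U(2)]
          frechet_derivative_inner_right[OF sm] in \<open>auto simp: differentiable_def\<close>)
    then show ?thesis using frechet_derivative_inner_right[OF smooth_open_deriv[OF sm] U(2)] by simp
  qed
  show "frechet_derivative (\<lambda>z. frechet_derivative f (at z) v) (at x) w \<bullet> b =
      frechet_derivative (\<lambda>z. frechet_derivative f (at z) w) (at x) v \<bullet> b"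
    using symmetric_second_derivative_real[OF U smb, of v w] by (simp only: eq)
qed

section \<open>The canonical flip\<close>

lemma velocity_eqI:
  assumes "(c has_vector_derivative v) (at 0)" "c 0 = x"
  shows "velocity c = (x, v)"
  using assms vector_derivative_at by (auto simp: velocity_def)

text \<open>With two arbitrary directions, both orders of differentiation of a family become
  instances of one formula.\<close>

lemma velocity_velocity:
  fixes x :: "'b::euclidean_space \<Rightarrow> 'a::euclidean_space"
  assumes W: "open W" "0 \<in> W" and sm: "smooth_open W x"
  shows "velocity (\<lambda>t. velocity (\<lambda>s. x (t *\<^sub>R e' + s *\<^sub>R e))) =
    ((x 0, frechet_derivative x (at 0) e),
     (frechet_derivative x (at 0) e',
      frechet_derivative (\<lambda>z. frechet_derivative x (at z) e) (at 0) e'))"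
proof (rule velocity_eqI)
  let ?D = "\<lambda>z. frechet_derivative x (at z) e"
  have inner: "velocity (\<lambda>s. x (t *\<^sub>R e' + s *\<^sub>R e)) = (x (t *\<^sub>R e'), ?D (t *\<^sub>R e'))" if "t *\<^sub>R e' \<in> W" for t
    using smooth_open_line_derivative[OF sm, of "t *\<^sub>R e'" 0 e] that by (intro velocity_eqI) auto
  have op: "open ((\<lambda>t::real. t *\<^sub>R e') -` W)"
    by (rule open_vimage[OF W(1)]) (intro continuous_intros)
  have "((\<lambda>t. (x (t *\<^sub>R e'), ?D (t *\<^sub>R e'))) has_vector_derivative
      (frechet_derivative x (at 0) e', frechet_derivative ?D (at 0) e')) (at 0)"
    using smooth_open_line_derivative[OF sm, of 0 0 e']
      smooth_open_line_derivative[OF smooth_open_deriv[OF sm], of 0 0 e'] W(2)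
    by (intro has_vector_derivative_Pair) auto
  then show "((\<lambda>t. velocity (\<lambda>s. x (t *\<^sub>R e' + s *\<^sub>R e))) has_vector_derivative
      (frechet_derivative x (at 0) e', frechet_derivative ?D (at 0) e')) (at 0)"
    by (rule has_vector_derivative_transform_within_open[OF _ op]) (use W(2) inner in auto)
  show "velocity (\<lambda>s. x (0 *\<^sub>R e' + s *\<^sub>R e)) = (x 0, frechet_derivative x (at 0) e)"
    using inner[of 0] W(2) by simp
qed

text \<open>By symmetry both orders are written with the same mixed derivative, so the two results
  visibly differ by an exchange of first-order entries.\<close>

lemma velocity_family:
  fixes x :: "real \<times> real \<Rightarrow> 'a::euclidean_space"
  assumes W: "open W" "(0, 0) \<in> W" and sm: "smooth_open W x"
  shows "velocity (\<lambda>t. velocity (\<lambda>s. x (s, t))) =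
    ((x (0, 0), frechet_derivative x (at (0, 0)) (1, 0)),
     (frechet_derivative x (at (0, 0)) (0, 1),
      frechet_derivative (\<lambda>z. frechet_derivative x (at z) (1, 0)) (at (0, 0)) (0, 1)))"
    and "velocity (\<lambda>s. velocity (\<lambda>t. x (s, t))) =
    ((x (0, 0), frechet_derivative x (at (0, 0)) (0, 1)),
     (frechet_derivative x (at (0, 0)) (1, 0),
      frechet_derivative (\<lambda>z. frechet_derivative x (at z) (1, 0)) (at (0, 0)) (0, 1)))"
  using velocity_velocity[OF W(1) _ sm, of "(0, 1)" "(1, 0)"]
    velocity_velocity[OF W(1) _ sm, of "(1, 0)" "(0, 1)"] W(2)
    symmetric_second_derivative[OF W sm, of "(1, 0)" "(0, 1)"]
  by (simp_all add: zero_prod_def)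

fun swap23 :: "('a \<times> 'a) \<times> ('a \<times> 'a) \<Rightarrow> ('a \<times> 'a) \<times> ('a \<times> 'a)" where
  "swap23 ((p, a), (u, b)) = ((p, u), (a, b))"

text \<open>Whatever family represents \<open>w\<close>, reversing the order yields
  \<open>swap23 w\<close>; one family in \<open>M\<close> therefore settles the definite
  description.\<close>

lemma canonical_flip_family:
  fixes x :: "real \<times> real \<Rightarrow> 'a::euclidean_space"
  assumes "open W" "(0, 0) \<in> W" "smooth_open W x" "x ` W \<subseteq> M"
    and w: "w = velocity (\<lambda>t. velocity (\<lambda>s. x (s, t)))"
  shows "canonical_flip M w = swap23 w"
  unfolding canonical_flip_def
proof (rule the_equality)
  show "\<exists>(x :: real \<times> real \<Rightarrow> 'a) W. open W \<and> (0, 0) \<in> W \<and> smooth_open W x \<and> x ` W \<subseteq> M \<and>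
     w = velocity (\<lambda>t. velocity (\<lambda>s. x (s, t))) \<and>
     swap23 w = velocity (\<lambda>s. velocity (\<lambda>t. x (s, t)))"
  proof (intro exI conjI)
    show "swap23 w = velocity (\<lambda>s. velocity (\<lambda>t. x (s, t)))"
      unfolding w velocity_family[OF assms(1-3)] by simp
  qed (rule assms)+
next
  fix w'
  assume "\<exists>(x :: real \<times> real \<Rightarrow> 'a) W. open W \<and> (0, 0) \<in> W \<and> smooth_open W x \<and> x ` W \<subseteq> M \<and>
     w = velocity (\<lambda>t. velocity (\<lambda>s. x (s, t))) \<and> w' = velocity (\<lambda>s. velocity (\<lambda>t. x (s, t)))"
  then obtain y :: "real \<times> real \<Rightarrow> 'a" and Y where y: "open Y" "(0, 0) \<in> Y" "smooth_open Y y"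
    "w = velocity (\<lambda>t. velocity (\<lambda>s. y (s, t)))" "w' = velocity (\<lambda>s. velocity (\<lambda>t. y (s, t)))"
    by blast
  show "w' = swap23 w"
    unfolding y(4,5) velocity_family[OF y(1-3)] by simp
qed

text \<open>A curve \<open>(c(t), a(t))\<close> in the tangent bundle is the inner velocity of the family
  \<open>r (c(t) + s a(t))\<close>.\<close>

lemma canonical_flip_tangent:
  fixes M :: "'a::euclidean_space set"
  assumes emb: "embedded_submanifold n M" and w: "w \<in> tangent_bundle (tangent_bundle M)"
  shows "canonical_flip M w = swap23 w" and "swap23 w \<in> tangent_bundle (tangent_bundle M)"
proof -
  obtain p a u b where wc: "w = ((p, a), (u, b))" by (metis surj_pair)
  have "(u, b) \<in> tangent_space (tangent_bundle M) (p, a)" using w wc by (simp add: tangent_bundle_def)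
  then obtain T C where C: "open T" "0 \<in> T" "smooth_open T C" "\<And>t. t \<in> T \<Longrightarrow> C t \<in> tangent_bundle M"
    "C 0 = (p, a)" "(C has_vector_derivative (u, b)) (at 0)"
    using tangent_spaceE by metis
  define c where "c t = fst (C t)" for t
  define \<alpha> where "\<alpha> t = snd (C t)" for t
  have smc: "smooth_open T c" "smooth_open T \<alpha>"
    unfolding c_def \<alpha>_def by (intro smooth_open_fst smooth_open_snd C)+
  have M: "c t \<in> M" "\<alpha> t \<in> tangent_space M (c t)" if "t \<in> T" for t
    using C(4)[OF that] by (auto simp: c_def \<alpha>_def tangent_bundle_def)
  have c0: "c 0 = p" "\<alpha> 0 = a" using C(5) by (auto simp: c_def \<alpha>_def)
  have "p \<in> M" using M(1) C(2) c0 by blast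
  then obtain U r where pU: "p \<in> U" and lr: "local_retraction M U r"
    using embedded_submanifold_local_retraction[OF emb] by blast
  note r = local_retractionD[OF lr]
  define q where "q z = c (snd z) + fst z *\<^sub>R \<alpha> (snd z)" for z :: "real \<times> real"
  have opT: "open (UNIV \<times> T)" using C(1) by (simp add: open_Times)
  have smq: "smooth_open (UNIV \<times> T) q"
    unfolding q_def
    by (intro smooth_open_add smooth_open_scaleR smooth_open_fst smooth_open_ident opT
        smooth_open_compose[OF opT _ smc(1)] smooth_open_compose[OF opT _ smc(2)] smooth_open_snd) auto
  define W where "W = (UNIV \<times> T) \<inter> q -` U"
  define x where "x z = r (q z)" for z
  have opW: "open W"
    unfolding W_def by (rule continuous_open_preimage[OF smooth_open_continuous[OF smq] opT r(1)])
  have W0: "(0, 0) \<in> W" using C(2) pU c0 by (simp add: W_def q_def)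
  have smx: "smooth_open W x"
    unfolding x_def by (rule smooth_open_compose[OF opW smooth_open_subset[OF smq] r(2)]) (auto simp: W_def)
  have xM: "x ` W \<subseteq> M" using r(3) by (auto simp: x_def W_def)
  have opc: "open (T \<inter> c -` U)"
    by (rule continuous_open_preimage[OF smooth_open_continuous[OF smc(1)] C(1) r(1)])
  \<comment> \<open>Composing with \<open>r\<close> keeps the family in \<open>M\<close> and changes
    nothing to first order at \<open>s = 0\<close>, since the derivative of \<open>r\<close> fixes
    tangent vectors.\<close>
  have inner: "velocity (\<lambda>s. x (s, t)) = C t" if t: "t \<in> T" "c t \<in> U" for t
  proof -
    have "((\<lambda>s. r (c t + s *\<^sub>R \<alpha> t)) has_vector_derivative frechet_derivative r (at (c t)) (\<alpha> t)) (at 0)"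
      using smooth_open_line_derivative[OF r(2), of "c t" 0 "\<alpha> t"] t by simp
    then show ?thesis
      using local_retraction_fixes_tangent[OF lr t(2) M(2)[OF t(1)]] r(5)[OF M(1)[OF t(1)] t(2)]
      by (intro trans[OF velocity_eqI]) (auto simp: x_def q_def c_def \<alpha>_def)
  qed
  have "((\<lambda>t. velocity (\<lambda>s. x (s, t))) has_vector_derivative (u, b)) (at 0)"
    by (rule has_vector_derivative_transform_within_open[OF C(6) opc]) (use C(2) c0 pU inner in auto)
  then have wv: "w = velocity (\<lambda>t. velocity (\<lambda>s. x (s, t)))"
    using inner[of 0] C(2,5) c0 pU wc velocity_eqI by metis
  then show "canonical_flip M w = swap23 w"
    by (rule canonical_flip_family[OF opW W0 smx xM])
  let ?D = "\<lambda>z. frechet_derivative x (at z) (0, 1)"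
  have comps: "x (0, 0) = p" "frechet_derivative x (at (0, 0)) (1, 0) = a" "?D (0, 0) = u"
    "frechet_derivative ?D (at (0, 0)) (1, 0) = b"
    using wv wc velocity_family(1)[OF opW W0 smx] symmetric_second_derivative[OF opW W0 smx, of "(1, 0)" "(0, 1)"]
    by auto
  \<comment> \<open>The witness is the curve of \<open>t\<close>-velocities of the same family. It
    stays in the tangent bundle because \<open>\<lambda>t. x (s, t)\<close> is a curve in
    \<open>M\<close> for each \<open>s\<close>.\<close>
  have "(a, b) \<in> tangent_space (tangent_bundle M) (p, u)"
  proof (rule tangent_spaceI)
    show op: "open ((\<lambda>s. (s, 0)) -` W)"
      by (rule open_vimage[OF opW]) (intro continuous_intros)
    show "0 \<in> (\<lambda>s. (s, 0)) -` W" using W0 by simp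
    show "smooth_open ((\<lambda>s. (s, 0)) -` W) (\<lambda>s. (x (s, 0), ?D (s, 0)))"
      by (intro smooth_open_Pair op smooth_open_compose[OF op _ smx]
          smooth_open_compose[OF op _ smooth_open_deriv[OF smx]] smooth_open_ident smooth_open_const) auto
    show "(x (s, 0), ?D (s, 0)) \<in> tangent_bundle M" if s: "s \<in> (\<lambda>s. (s, 0)) -` W" for s
    proof -
      have "?D (s, 0) \<in> tangent_space M (x (s, 0))"
      proof (rule tangent_spaceI)
        show opt: "open ((\<lambda>t. (s, t)) -` W)"
          by (rule open_vimage[OF opW]) (intro continuous_intros)
        show "0 \<in> (\<lambda>t. (s, t)) -` W" using s by simp
        show "smooth_open ((\<lambda>t. (s, t)) -` W) (\<lambda>t. x (s, t))"
          by (intro opt smooth_open_compose[OF opt _ smx] smooth_open_Pair smooth_open_ident smooth_open_const) auto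
        show "x (s, t) \<in> M" if "t \<in> (\<lambda>t. (s, t)) -` W" for t using that xM by auto
        show "((\<lambda>t. x (s, t)) has_vector_derivative ?D (s, 0)) (at 0)"
          using smooth_open_line_derivative[OF smx, of "(s, 0)" 0 "(0, 1)"] s by simp
      qed simp
      then show ?thesis using s xM by (auto simp: tangent_bundle_def)
    qed
    show "(x (0, 0), ?D (0, 0)) = (p, u)" using comps by simp
    show "((\<lambda>s. (x (s, 0), ?D (s, 0))) has_vector_derivative (a, b)) (at 0)"
      using smooth_open_line_derivative[OF smx, of "(0, 0)" 0 "(1, 0)"]
        smooth_open_line_derivative[OF smooth_open_deriv[OF smx], of "(0, 0)" 0 "(1, 0)"] W0 comps
      by (intro has_vector_derivative_Pair) auto
  qed
  moreover have "u \<in> tangent_space M p"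
  proof (rule tangent_spaceI[OF C(1,2) smc(1) M(1) c0(1)])
    show "(c has_vector_derivative u) (at 0)"
      unfolding c_def using smooth_curve_vector_derivative[OF C(6) has_derivative_fst[OF has_derivative_ident]]
      by simp
  qed
  ultimately show "swap23 w \<in> tangent_bundle (tangent_bundle M)"
    using wc \<open>p \<in> M\<close> by (simp add: tangent_bundle_def)
qed

section \<open>The tangent bundle as a submanifold\<close>

lemma smooth_open_tangent_map:
  fixes f :: "'a::euclidean_space \<Rightarrow> 'b::euclidean_space"
  assumes "open U" "smooth_open U f"
  shows "smooth_open (U \<times> UNIV) (\<lambda>z. (f (fst z), frechet_derivative f (at (fst z)) (snd z)))"
proof -
  have op: "open (U \<times> (UNIV :: 'a set))" using assms(1) by (simp add: open_Times)
  show ?thesis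
    by (intro smooth_open_Pair smooth_open_compose[OF op _ assms(2)]
        smooth_open_deriv_apply[OF op assms(2)] smooth_open_fst smooth_open_snd smooth_open_ident op) auto
qed

lemma inverse_derivative_apply:
  assumes "open U" "smooth_open U f" "smooth_open V h" "\<And>x. x \<in> U \<Longrightarrow> f x \<in> V"
    and "\<And>x. x \<in> U \<Longrightarrow> h (f x) = x" "x \<in> U"
  shows "frechet_derivative h (at (f x)) (frechet_derivative f (at x) v) = v"
proof -
  have "((\<lambda>x. x) has_derivative (\<lambda>v. frechet_derivative h (at (f x)) (frechet_derivative f (at x) v))) (at x)"
    by (rule has_derivative_transform_within_open[OF has_derivative_compose[OF
          smooth_open_has_derivative[OF assms(2,6)] smooth_open_has_derivative[OF assms(3) assms(4)[OF assms(6)]]]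
          assms(1,6)]) (rule assms(5))
  then show ?thesis using has_derivative_unique[OF _ has_derivative_ident] by metis
qed

text \<open>The tangent map of a flattening chart flattens the bundle onto
  \<open>S \<times> S\<close>; its inverse is the tangent map of the inverse chart.\<close>

lemma embedded_submanifold_tangent_bundle:
  fixes M :: "'a::euclidean_space set"
  assumes emb: "embedded_submanifold n M"
  shows "embedded_submanifold (n + n) (tangent_bundle M)"
  unfolding embedded_submanifold_def
proof
  fix z assume z: "z \<in> tangent_bundle M"
  then have pM: "fst z \<in> M" by (auto simp: tangent_bundle_def)
  obtain U V \<phi> \<psi> and S :: "'a set" where
    *: "open U" "fst z \<in> U" "open V" "smooth_open U \<phi>" "smooth_open V \<psi>" "homeomorphism U V \<phi> \<psi>"
      "subspace S" "dim S = n" "\<phi> ` (M \<inter> U) = S \<inter> V"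
    using bspec[OF emb[unfolded embedded_submanifold_def] pM] by (elim exE conjE) (rule that)
  have hom: "\<And>x. x \<in> U \<Longrightarrow> \<phi> x \<in> V" "\<And>y. y \<in> V \<Longrightarrow> \<psi> y \<in> U"
    "\<And>x. x \<in> U \<Longrightarrow> \<psi> (\<phi> x) = x" "\<And>y. y \<in> V \<Longrightarrow> \<phi> (\<psi> y) = y"
    using *(6) by (auto simp: homeomorphism_def)
  note inv1 = inverse_derivative_apply[OF *(1,4,5) hom(1,3)]
  note inv2 = inverse_derivative_apply[OF *(3,5,4) hom(2,4)]
  define \<Phi> where "\<Phi> y = (\<phi> (fst y), frechet_derivative \<phi> (at (fst y)) (snd y))" for y
  define \<Psi> where "\<Psi> y = (\<psi> (fst y), frechet_derivative \<psi> (at (fst y)) (snd y))" for y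
  have sm: "smooth_open (U \<times> UNIV) \<Phi>" "smooth_open (V \<times> UNIV) \<Psi>"
    unfolding \<Phi>_def \<Psi>_def by (intro smooth_open_tangent_map *)+
  have "homeomorphism (U \<times> UNIV) (V \<times> UNIV) \<Phi> \<Psi>"
    by (rule homeomorphismI[OF smooth_open_continuous[OF sm(1)] smooth_open_continuous[OF sm(2)]])
      (use hom inv1 inv2 in \<open>auto simp: \<Phi>_def \<Psi>_def\<close>)
  moreover have "\<Phi> ` (tangent_bundle M \<inter> U \<times> UNIV) = (S \<times> S) \<inter> (V \<times> UNIV)"
  proof (intro equalityI subsetI)
    fix y assume "y \<in> \<Phi> ` (tangent_bundle M \<inter> U \<times> UNIV)"
    then obtain x v where xv: "x \<in> M" "v \<in> tangent_space M x" "x \<in> U" "y = \<Phi> (x, v)"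
      by (auto simp: tangent_bundle_def)
    obtain T c where c: "open T" "0 \<in> T" "smooth_open T c" "\<And>t. t \<in> T \<Longrightarrow> c t \<in> M"
      "c 0 = x" "(c has_vector_derivative v) (at 0)"
      using tangent_spaceE[OF xv(2)] by blast
    let ?v = "frechet_derivative \<phi> (at x) v"
    have op: "open (T \<inter> c -` U)"
      by (rule continuous_open_preimage[OF smooth_open_continuous[OF c(3)] c(1) *(1)])
    have d: "((\<lambda>t. \<phi> (c t)) has_vector_derivative ?v) (at 0)"
      using smooth_curve_vector_derivative[OF c(6)] smooth_open_has_derivative[OF *(4) xv(3)] c(5) by blast
    \<comment> \<open>A curve in \<open>S\<close> equals its own projection; differentiating this
      puts its velocity in \<open>S\<close>.\<close>
    have "bounded_linear (orth_proj S)"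
      using linear_orth_proj[OF *(7)] by (simp add: linear_conv_bounded_linear)
    from bounded_linear.has_vector_derivative[OF this d]
    have "((\<lambda>t. \<phi> (c t)) has_vector_derivative orth_proj S ?v) (at 0)"
    proof (rule has_vector_derivative_transform_within_open[OF _ op])
      show "orth_proj S (\<phi> (c t)) = \<phi> (c t)" if "t \<in> T \<inter> c -` U" for t
        using that c(4) *(9) by (intro orth_proj_ident[OF *(7)]) blast
    qed (use c xv in auto)
    then have "?v = orth_proj S ?v" by (rule vector_derivative_unique_at[OF d])
    then have "?v \<in> S" using orth_proj_mem[OF *(7)] by metis
    moreover have "\<phi> x \<in> S \<inter> V" using *(9) xv by blast
    ultimately show "y \<in> (S \<times> S) \<inter> (V \<times> UNIV)" using xv(4) by (auto simp: \<Phi>_def)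
  next
    fix y assume y: "y \<in> (S \<times> S) \<inter> (V \<times> UNIV)"
    obtain s w where sw: "y = (s, w)" "s \<in> S" "w \<in> S" "s \<in> V" using y by auto
    have line: "\<psi> s' \<in> M" if s': "s' \<in> S \<inter> V" for s'
    proof -
      obtain m where "m \<in> M \<inter> U" "s' = \<phi> m" using s' *(9) by blast
      then show ?thesis using hom(3) by auto
    qed
    have smc: "smooth_open UNIV (\<lambda>t::real. s + t *\<^sub>R w)"
      by (intro smooth_open_add smooth_open_scaleR smooth_open_const smooth_open_ident open_UNIV)
    have op: "open ((\<lambda>t::real. s + t *\<^sub>R w) -` V)"
      by (rule open_vimage[OF *(3)]) (intro continuous_intros)
    \<comment> \<open>Conversely, a straight line in \<open>S\<close> is pulled back to a curve in
      \<open>M\<close>.\<close>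
    have "frechet_derivative \<psi> (at s) w \<in> tangent_space M (\<psi> s)"
    proof (rule tangent_spaceI[OF op, where c = "\<lambda>t. \<psi> (s + t *\<^sub>R w)"])
      show "smooth_open ((\<lambda>t. s + t *\<^sub>R w) -` V) (\<lambda>t. \<psi> (s + t *\<^sub>R w))"
        by (rule smooth_open_compose[OF op smooth_open_subset[OF smc] *(5)]) auto
      show "((\<lambda>t. \<psi> (s + t *\<^sub>R w)) has_vector_derivative frechet_derivative \<psi> (at s) w) (at 0)"
        using smooth_open_line_derivative[OF *(5), of s 0 w] sw by simp
      show "\<psi> (s + t *\<^sub>R w) \<in> M" if "t \<in> (\<lambda>t. s + t *\<^sub>R w) -` V" for t
        using that sw *(7) by (intro line) (auto intro: subspace_add subspace_scale)
    qed (use sw in auto)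
    then have "\<Psi> y \<in> tangent_bundle M \<inter> U \<times> UNIV"
      using line sw hom(2) by (auto simp: \<Psi>_def tangent_bundle_def)
    moreover have "\<Phi> (\<Psi> y) = y" using sw hom inv2 by (auto simp: \<Phi>_def \<Psi>_def)
    ultimately show "y \<in> \<Phi> ` (tangent_bundle M \<inter> U \<times> UNIV)" by (metis imageI)
  qed
  moreover have "dim (S \<times> S) = n + n" using dim_Times[OF *(7,7)] *(8) by simp
  moreover have "open (U \<times> (UNIV :: 'a set))" "open (V \<times> (UNIV :: 'a set))" "z \<in> U \<times> UNIV" "subspace (S \<times> S)"
    using * by (auto simp: open_Times mem_Times_iff intro: subspace_Times)
  ultimately show "\<exists>U V \<phi> \<psi> (S :: ('a \<times> 'a) set).
        open U \<and> z \<in> U \<and> open V \<and> smooth_open U \<phi> \<and> smooth_open V \<psi> \<and>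
        homeomorphism U V \<phi> \<psi> \<and> subspace S \<and> dim S = n + n \<and> \<phi> ` (tangent_bundle M \<inter> U) = S \<inter> V"
    using sm by (intro exI[of _ "U \<times> UNIV"] exI[of _ "V \<times> UNIV"] exI[of _ \<Phi>] exI[of _ \<Psi>]
        exI[of _ "S \<times> S"] conjI) 
qed

section \<open>Differentials along a submanifold\<close>

text \<open>Along a curve in \<open>N\<close> the map and its extension coincide, and one curve has
  only one velocity.\<close>

lemma tangent_space_has_derivative:
  fixes f F :: "'a::euclidean_space \<Rightarrow> 'b::euclidean_space"
  assumes F: "open U" "(F has_derivative F') (at x)" "x \<in> U" "\<And>z. z \<in> N \<Longrightarrow> z \<in> U \<Longrightarrow> F z = f z"
    and v: "v \<in> tangent_space N x"
    and L: "(f has_derivative L) (at x within N)"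
  shows "L v = F' v"
proof -
  obtain T c where c: "open T" "0 \<in> T" "smooth_open T c" "\<And>t. t \<in> T \<Longrightarrow> c t \<in> N"
    "c 0 = x" "(c has_vector_derivative v) (at 0)"
    using tangent_spaceE[OF v] by blast
  have op: "open (T \<inter> c -` U)"
    by (rule continuous_open_preimage[OF smooth_open_continuous[OF c(3)] c(1) F(1)])
  have "((\<lambda>t. F (c t)) has_vector_derivative F' v) (at 0)"
    using smooth_curve_vector_derivative[OF c(6), of F F'] F(2) c(5) by simp
  then have 1: "((\<lambda>t. f (c t)) has_vector_derivative F' v) (at 0)"
    by (rule has_vector_derivative_transform_within_open[OF _ op]) (use c F in auto)
  have "c ` T \<subseteq> N" using c(4) by blast
  then have "(f has_derivative L) (at (c 0) within c ` T)"
    using has_derivative_subset[OF L] c(5) by simp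
  then have "((f \<circ> c) has_vector_derivative L v) (at 0 within T)"
    by (rule vector_derivative_diff_chain_within[OF has_vector_derivative_at_within[OF c(6)]])
  then have "((\<lambda>t. f (c t)) has_vector_derivative L v) (at 0)"
    using at_within_open[OF c(2,1)] by (simp add: o_def)
  then show ?thesis by (rule vector_derivative_unique_at[OF _ 1])
qed

lemma mdiff_eq:
  fixes f F :: "'a::euclidean_space \<Rightarrow> 'b::euclidean_space"
  assumes F: "open U" "(F has_derivative F') (at x)" "x \<in> U" "x \<in> N"
    "\<And>z. z \<in> N \<Longrightarrow> z \<in> U \<Longrightarrow> F z = f z"
    and v: "v \<in> tangent_space N x"
  shows "mdiff N f x v = F' v"
proof -
  obtain d where d: "0 < d" "ball x d \<subseteq> U" using F(1,3) open_contains_ball by metis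
  have "(f has_derivative F') (at x within N)"
    by (rule has_derivative_transform_within[OF has_derivative_at_withinI[OF F(2)] d(1) F(4)])
      (use d F(5) in \<open>auto simp: dist_commute subset_iff\<close>)
  \<comment> \<open>\<open>mdiff\<close> uses a chosen derivative within \<open>N\<close>. As one
    derivative exists, the choice is a derivative too, and its value on \<open>v\<close> is
    forced.\<close>
  then have L: "(f has_derivative frechet_derivative f (at x within N)) (at x within N)"
    by (auto simp: frechet_derivative_works[symmetric] differentiable_def)
  show ?thesis
    unfolding mdiff_def by (rule tangent_space_has_derivative[OF F(1-3,5) v L])
qed

lemma derivative_mem_tangent_space:
  assumes F: "open U" "smooth_open U F" "x \<in> U" "\<And>z. z \<in> N \<Longrightarrow> z \<in> U \<Longrightarrow> F z \<in> N'"
    and v: "v \<in> tangent_space N x"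
  shows "frechet_derivative F (at x) v \<in> tangent_space N' (F x)"
proof -
  obtain T c where c: "open T" "0 \<in> T" "smooth_open T c" "\<And>t. t \<in> T \<Longrightarrow> c t \<in> N"
    "c 0 = x" "(c has_vector_derivative v) (at 0)"
    using tangent_spaceE[OF v] by blast
  have op: "open (T \<inter> c -` U)"
    by (rule continuous_open_preimage[OF smooth_open_continuous[OF c(3)] c(1) F(1)])
  show ?thesis
  proof (rule tangent_spaceI[OF op, where c = "\<lambda>t. F (c t)"])
    show "smooth_open (T \<inter> c -` U) (\<lambda>t. F (c t))"
      by (rule smooth_open_compose[OF op smooth_open_subset[OF c(3)] F(2)]) auto
    show "((\<lambda>t. F (c t)) has_vector_derivative frechet_derivative F (at x) v) (at 0)"
      using smooth_curve_vector_derivative[OF c(6), of F] smooth_open_has_derivative[OF F(2,3)] c(5) by simp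
  qed (use c F in auto)
qed

lemma tangent_space_Times:
  assumes "u \<in> tangent_space M x" "v \<in> tangent_space N y"
  shows "(u, v) \<in> tangent_space (M \<times> N) (x, y)"
proof -
  obtain T c where c: "open T" "0 \<in> T" "smooth_open T c" "\<And>t. t \<in> T \<Longrightarrow> c t \<in> M"
    "c 0 = x" "(c has_vector_derivative u) (at 0)"
    using tangent_spaceE[OF assms(1)] by blast
  obtain T' c' where c': "open T'" "0 \<in> T'" "smooth_open T' c'" "\<And>t. t \<in> T' \<Longrightarrow> c' t \<in> N"
    "c' 0 = y" "(c' has_vector_derivative v) (at 0)"
    using tangent_spaceE[OF assms(2)] by blast
  have op: "open (T \<inter> T')" using c(1) c'(1) by blast
  show ?thesis
  proof (rule tangent_spaceI[OF op, where c = "\<lambda>t. (c t, c' t)"])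
    show "smooth_open (T \<inter> T') (\<lambda>t. (c t, c' t))"
      using smooth_open_subset[OF c(3)] smooth_open_subset[OF c'(3)] by (intro smooth_open_Pair op) auto
    show "((\<lambda>t. (c t, c' t)) has_vector_derivative (u, v)) (at 0)"
      by (rule has_vector_derivative_Pair[OF c(6) c'(6)])
  qed (use c c' in auto)
qed

section \<open>The derivative of the tangential projection\<close>

abbreviation (input) tproj :: "'a::euclidean_space set \<Rightarrow> 'a \<Rightarrow> 'a \<Rightarrow> 'a" where
  "tproj M x \<equiv> orth_proj (tangent_space M x)"

text \<open>Fixing \<open>w\<close> makes this the differential of a vector-valued map, so no
  operator-valued map is differentiated.\<close>

definition dproj :: "'a::euclidean_space set \<Rightarrow> 'a \<Rightarrow> 'a \<Rightarrow> 'a \<Rightarrow> 'a" where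
  "dproj M x u w = mdiff M (\<lambda>y. tproj M y w) x u"

text \<open>Off \<open>M\<close> the values are still orthogonal projections onto tangent spaces.
  Idempotence and self-adjointness thus hold on an open set and may be differentiated there.\<close>

definition proj_extension :: "'a::euclidean_space set \<Rightarrow> 'a set \<Rightarrow> ('a \<Rightarrow> 'a \<Rightarrow> 'a) \<Rightarrow> bool" where
  "proj_extension M U F \<longleftrightarrow> open U \<and> (\<forall>w. smooth_open U (\<lambda>z. F z w)) \<and>
     (\<forall>z\<in>U. \<exists>y\<in>M. F z = tproj M y) \<and> (\<forall>z\<in>M \<inter> U. F z = tproj M z)"

lemma proj_extension_exists:
  assumes "embedded_submanifold n M" "x \<in> M"
  obtains U F where "x \<in> U" "proj_extension M U F"
proof -
  obtain U r where U: "x \<in> U" and lr: "local_retraction M U r"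
    using embedded_submanifold_local_retraction[OF assms] by blast
  have "proj_extension M U (\<lambda>z. tproj M (r z))"
    unfolding proj_extension_def
    using local_retractionD[OF lr] smooth_open_tangent_proj[OF lr] by auto
  with U that show ?thesis by blast
qed

lemma proj_extensionD:
  assumes "proj_extension M U F"
  shows "open U" "\<And>w. smooth_open U (\<lambda>z. F z w)" "\<And>z. z \<in> M \<Longrightarrow> z \<in> U \<Longrightarrow> F z = tproj M z"
    "\<And>z. z \<in> U \<Longrightarrow> \<exists>y\<in>M. F z = tproj M y"
  using assms unfolding proj_extension_def by blast+

lemma proj_extension_linear:
  assumes "embedded_submanifold n M" "proj_extension M U F" "z \<in> U"
  shows "linear (F z)" "F z (F z w) = F z w" "F z v \<bullet> w = v \<bullet> F z w"
proof -
  obtain y where y: "y \<in> M" "F z = tproj M y" using proj_extensionD(4)[OF assms(2,3)] by blast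
  have sub: "subspace (tangent_space M y)" by (rule subspace_tangent_space[OF assms(1) y(1)])
  show "linear (F z)" unfolding y(2) by (rule linear_orth_proj[OF sub])
  show "F z (F z w) = F z w"
    unfolding y(2) by (rule orth_proj_ident[OF sub orth_proj_mem[OF sub]])
  show "F z v \<bullet> w = v \<bullet> F z w" unfolding y(2) by (rule orth_proj_adjoint[OF sub])
qed

lemma dproj_eq:
  assumes "proj_extension M U F" "x \<in> U" "x \<in> M" "u \<in> tangent_space M x"
  shows "dproj M x u w = frechet_derivative (\<lambda>z. F z w) (at x) u"
  unfolding dproj_def
  by (rule mdiff_eq[OF proj_extensionD(1)[OF assms(1)]
        smooth_open_has_derivative[OF proj_extensionD(2)[OF assms(1)] assms(2)] assms(2,3) _ assms(4)])
    (simp add: proj_extensionD(3)[OF assms(1)])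

lemma proj_extension_has_derivative:
  assumes "proj_extension M U F" "x \<in> U"
  shows "((\<lambda>z. F z w) has_derivative frechet_derivative (\<lambda>z. F z w) (at x)) (at x)"
  by (rule smooth_open_has_derivative[OF proj_extensionD(2)[OF assms(1)] assms(2)])

context
  fixes M :: "'a::euclidean_space set" and n x u
  assumes emb: "embedded_submanifold n M" and x: "x \<in> M" and u: "u \<in> tangent_space M x"
begin

lemma linear_dproj: "linear (dproj M x u)"
proof -
  obtain U F where U: "x \<in> U" and F: "proj_extension M U F"
    using proj_extension_exists[OF emb x] by blast
  have "linear (\<lambda>w. frechet_derivative (\<lambda>z. F z w) (at x) u)"
    by (rule linear_family_derivative[OF proj_extensionD(1)[OF F] U proj_extension_linear(1)[OF emb F]
          proj_extension_has_derivative[OF F U]])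
  moreover have "dproj M x u = (\<lambda>w. frechet_derivative (\<lambda>z. F z w) (at x) u)"
    by (rule ext) (rule dproj_eq[OF F U x u])
  ultimately show ?thesis by simp
qed

text \<open>Differentiate \<open>P\<^sup>2 = P\<close>.\<close>

lemma dproj_idempotent: "dproj M x u (tproj M x w) + tproj M x (dproj M x u w) = dproj M x u w"
proof -
  obtain U F where U: "x \<in> U" and F: "proj_extension M U F"
    using proj_extension_exists[OF emb x] by blast
  note lin = proj_extension_linear[OF emb F]
  let ?D = "\<lambda>w. frechet_derivative (\<lambda>z. F z w) (at x)"
  have "((\<lambda>z. F z (F z w)) has_derivative (\<lambda>v. ?D (F x w) v + F x (?D w v))) (at x)"
    by (rule has_derivative_apply_linear[OF proj_extensionD(1)[OF F] U lin(1)
          proj_extension_has_derivative[OF F U] proj_extension_has_derivative[OF F U]])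
  then have "((\<lambda>z. F z w) has_derivative (\<lambda>v. ?D (F x w) v + F x (?D w v))) (at x)"
    by (rule has_derivative_transform_within_open[OF _ proj_extensionD(1)[OF F] U]) (rule lin(2))
  then have "?D (F x w) u + F x (?D w u) = ?D w u"
    using has_derivative_unique[OF proj_extension_has_derivative[OF F U]] by metis
  then show ?thesis using dproj_eq[OF F U x u] proj_extensionD(3)[OF F x U] by simp
qed

text \<open>Self-adjointness of the projections holds throughout \<open>U\<close> for the extension
  and survives differentiation.\<close>

lemma dproj_adjoint: "dproj M x u v \<bullet> w = v \<bullet> dproj M x u w"
proof -
  obtain U F where U: "x \<in> U" and F: "proj_extension M U F"
    using proj_extension_exists[OF emb x] by blast
  let ?D = "\<lambda>w. frechet_derivative (\<lambda>z. F z w) (at x)"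
  note d = proj_extension_has_derivative[OF F U]
  have "((\<lambda>z. v \<bullet> F z w) has_derivative (\<lambda>h. ?D v h \<bullet> w)) (at x)"
    by (rule has_derivative_transform_within_open[OF has_derivative_inner_left[OF d]
          proj_extensionD(1)[OF F] U]) (rule proj_extension_linear(3)[OF emb F])
  then have "(\<lambda>h. ?D v h \<bullet> w) = (\<lambda>h. v \<bullet> ?D w h)"
    using has_derivative_unique has_derivative_inner_right[OF d] by blast
  then show ?thesis using dproj_eq[OF F U x u] by (metis (no_types))
qed

lemma dproj_tangent: "w \<in> tangent_space M x \<Longrightarrow> dproj M x u w \<in> normal_space_at M x"
  using dproj_idempotent[of w] subspace_tangent_space[OF emb x]
  by (simp add: orth_proj_ident orth_proj_zero_iff)

text \<open>With \<open>tproj M x w = 0\<close>, the differentiated idempotence says that the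
  projection fixes \<open>dproj M x u w\<close>.\<close>

lemma dproj_normal:
  assumes "w \<in> normal_space_at M x"
  shows "dproj M x u w \<in> tangent_space M x"
proof -
  have sub: "subspace (tangent_space M x)" by (rule subspace_tangent_space[OF emb x])
  have "tproj M x w = 0" using assms orth_proj_zero_iff[OF sub] by blast
  then have "tproj M x (dproj M x u w) = dproj M x u w"
    using dproj_idempotent[of w] linear_0[OF linear_dproj] by simp
  then show ?thesis using orth_proj_mem[OF sub] by metis
qed

end

section \<open>Levi-Civita connection and second fundamental form\<close>

lemma vector_field_tproj:
  assumes emb: "embedded_submanifold n M"
  shows "vector_field M (\<lambda>y. tproj M y w)"
  unfolding vector_field_def smooth_map_def
proof (intro conjI ballI)
  fix p assume p: "p \<in> M"
  show "tproj M p w \<in> tangent_space M p"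
    by (rule orth_proj_mem[OF subspace_tangent_space[OF emb p]])
  obtain U F where U: "p \<in> U" and F: "proj_extension M U F"
    using proj_extension_exists[OF emb p] by blast
  show "\<exists>U F. open U \<and> p \<in> U \<and> smooth_open U F \<and> (\<forall>x\<in>M \<inter> U. F x = tproj M x w)"
    using U proj_extensionD[OF F] by (intro exI[of _ U] exI[of _ "\<lambda>z. F z w"]) auto
qed

lemma normal_field_tproj:
  assumes emb: "embedded_submanifold n M"
  shows "normal_field M (\<lambda>y. w - tproj M y w)"
  unfolding normal_field_def smooth_map_def
proof (intro conjI ballI)
  fix p assume p: "p \<in> M"
  show "w - tproj M p w \<in> normal_space_at M p"
    by (rule orth_proj_perp[OF subspace_tangent_space[OF emb p]])
  obtain U F where U: "p \<in> U" and F: "proj_extension M U F"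
    using proj_extension_exists[OF emb p] by blast
  show "\<exists>U F. open U \<and> p \<in> U \<and> smooth_open U F \<and> (\<forall>x\<in>M \<inter> U. F x = w - tproj M x w)"
    using U proj_extensionD[OF F]
    by (intro exI[of _ U] exI[of _ "\<lambda>z. w - F z w"]) (auto intro: smooth_open_diff smooth_open_const)
qed

lemma tangent_normal_zero:
  "v \<in> tangent_space M x \<Longrightarrow> v \<in> normal_space_at M x \<Longrightarrow> v = 0"
  using orthogonal_self[of v] unfolding orthogonal_comp_def by blast

text \<open>The form \<open>T(u, w, z) = \<langle>\<nabla>\<^sub>u w, z\<rangle>\<close> on the projected constant fields is symmetric in the first
  two and antisymmetric in the last two arguments, so it vanishes.\<close>

lemma symmetric_antisymmetric_form_zero:
  fixes T :: "'v \<Rightarrow> 'v \<Rightarrow> 'v \<Rightarrow> real"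
  assumes "\<And>a b c. a \<in> S \<Longrightarrow> b \<in> S \<Longrightarrow> c \<in> S \<Longrightarrow> T a b c = T b a c"
    and "\<And>a b c. a \<in> S \<Longrightarrow> b \<in> S \<Longrightarrow> c \<in> S \<Longrightarrow> T a b c = - T a c b"
    and "a \<in> S" "b \<in> S" "c \<in> S"
  shows "T a b c = 0"
proof -
  have "T a b c = - T b c a" using assms by metis
  also have "\<dots> = T c a b" using assms by (metis minus_minus)
  also have "\<dots> = - T a b c" using assms by metis
  finally show ?thesis by simp
qed

context
  fixes M :: "'a::euclidean_space set" and m g nabla
  assumes riem: "riemannian_submanifold m M g" and lc: "levi_civita M g nabla"
begin

lemma embedded: "embedded_submanifold m M"
  using riem by (simp add: riemannian_submanifold_def)

lemma metric_eq_inner: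
  "x \<in> M \<Longrightarrow> u \<in> tangent_space M x \<Longrightarrow> v \<in> tangent_space M x \<Longrightarrow> g x u v = u \<bullet> v"
  using riem by (simp add: riemannian_submanifold_def)

lemma nabla_tangent:
  assumes "x \<in> M"
  shows "nabla (\<lambda>y. tproj M y u) (\<lambda>y. tproj M y w) x \<in> tangent_space M x"
  using lc[unfolded levi_civita_def affine_connection_def, THEN conjunct1, THEN conjunct1, rule_format,
      OF vector_field_tproj[OF embedded, of u] vector_field_tproj[OF embedded, of w]] assms
  by (simp add: vector_field_def)

lemma flat_D_tproj:
  assumes "x \<in> M" "u \<in> tangent_space M x"
  shows "flat_D M (\<lambda>y. tproj M y u) (\<lambda>y. tproj M y w) x = dproj M x u w"
  using orth_proj_ident[OF subspace_tangent_space[OF embedded assms(1)] assms(2)]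
  by (simp add: flat_D_def dproj_def)

text \<open>Torsion-freeness equates a tangent difference with a normal one, so both vanish.\<close>

lemma nabla_dproj_commute:
  assumes x: "x \<in> M" and u: "u \<in> tangent_space M x" and w: "w \<in> tangent_space M x"
  shows "nabla (\<lambda>y. tproj M y u) (\<lambda>y. tproj M y w) x = nabla (\<lambda>y. tproj M y w) (\<lambda>y. tproj M y u) x"
    and "dproj M x u w = dproj M x w u"
proof -
  let ?N = "\<lambda>u w. nabla (\<lambda>y. tproj M y u) (\<lambda>y. tproj M y w) x"
  have eq: "?N u w - ?N w u = dproj M x u w - dproj M x w u"
    using lc[unfolded levi_civita_def lie_bracket_def, THEN conjunct2, THEN conjunct1, rule_format,
        OF vector_field_tproj[OF embedded, of u] vector_field_tproj[OF embedded, of w] x]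
    by (simp only: flat_D_tproj[OF x u] flat_D_tproj[OF x w])
  moreover have "?N u w - ?N w u \<in> tangent_space M x"
    by (intro subspace_diff subspace_tangent_space[OF embedded x] nabla_tangent x)
  moreover have "dproj M x u w - dproj M x w u \<in> normal_space_at M x"
    by (intro subspace_diff subspace_orthogonal_comp dproj_tangent[OF embedded x] u w)
  ultimately have "dproj M x u w - dproj M x w u = 0" using tangent_normal_zero by metis
  then show "dproj M x u w = dproj M x w u" "?N u w = ?N w u" using eq by simp_all
qed

text \<open>The metric of two projected constant fields is stationary at \<open>x\<close> in
  direction \<open>u\<close>, because \<open>dproj\<close> sends tangent vectors to normal ones.
  Compatibility turns this into antisymmetry.\<close>

lemma nabla_metric:
  assumes x: "x \<in> M" and u: "u \<in> tangent_space M x" and w: "w \<in> tangent_space M x"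
    and z: "z \<in> tangent_space M x"
  shows "nabla (\<lambda>y. tproj M y u) (\<lambda>y. tproj M y w) x \<bullet> z =
    - (nabla (\<lambda>y. tproj M y u) (\<lambda>y. tproj M y z) x \<bullet> w)"
proof -
  let ?N = "\<lambda>u w. nabla (\<lambda>y. tproj M y u) (\<lambda>y. tproj M y w) x"
  have P: "tproj M x v = v" if "v \<in> tangent_space M x" for v
    by (rule orth_proj_ident[OF subspace_tangent_space[OF embedded x] that])
  obtain U F where U: "x \<in> U" and F: "proj_extension M U F"
    using proj_extension_exists[OF embedded x] by blast
  let ?D = "\<lambda>w. frechet_derivative (\<lambda>z. F z w) (at x)"
  note d = proj_extension_has_derivative[OF F U]
  have "mdiff M (\<lambda>y. g y (tproj M y w) (tproj M y z)) x u = F x w \<bullet> ?D z u + ?D w u \<bullet> F x z"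
  proof (rule mdiff_eq[OF proj_extensionD(1)[OF F] has_derivative_inner[OF d d] U x _ u])
    show "F y w \<bullet> F y z = g y (tproj M y w) (tproj M y z)" if y: "y \<in> M" "y \<in> U" for y
      using metric_eq_inner[OF y(1)] orth_proj_mem[OF subspace_tangent_space[OF embedded y(1)]]
        proj_extensionD(3)[OF F y] by simp
  qed
  also have "\<dots> = w \<bullet> dproj M x u z + dproj M x u w \<bullet> z"
    using dproj_eq[OF F U x u] proj_extensionD(3)[OF F x U] P w z by simp
  also have "\<dots> = 0"
    using dproj_tangent[OF embedded x u w] dproj_tangent[OF embedded x u z] w z
    by (simp add: orthogonal_comp_def orthogonal_def inner_commute)
  finally have "flat_D M (\<lambda>y. tproj M y u) (\<lambda>y. g y (tproj M y w) (tproj M y z)) x = 0"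
    by (simp add: flat_D_def P u)
  moreover have "flat_D M (\<lambda>y. tproj M y u) (\<lambda>y. g y (tproj M y w) (tproj M y z)) x =
      g x (?N u w) (tproj M x z) + g x (tproj M x w) (?N u z)"
    by (rule lc[unfolded levi_civita_def, THEN conjunct2, THEN conjunct2, rule_format,
          OF vector_field_tproj[OF embedded] vector_field_tproj[OF embedded] vector_field_tproj[OF embedded] x])
  ultimately show ?thesis
    using nabla_tangent[OF x] metric_eq_inner[OF x] P w z by (simp add: inner_commute)
qed

lemma nabla_tproj_zero:
  assumes x: "x \<in> M" and u: "u \<in> tangent_space M x" and w: "w \<in> tangent_space M x"
  shows "nabla (\<lambda>y. tproj M y u) (\<lambda>y. tproj M y w) x = 0"
proof -
  let ?N = "\<lambda>u w. nabla (\<lambda>y. tproj M y u) (\<lambda>y. tproj M y w) x"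
  \<comment> \<open>\<open>?N u w\<close> is itself tangent and may serve as the third argument of
    the form.\<close>
  have "?N u w \<bullet> ?N u w = 0"
  proof (rule symmetric_antisymmetric_form_zero[where T = "\<lambda>a b c. ?N a b \<bullet> c" and S = "tangent_space M x"])
    show "?N a b \<bullet> c = ?N b a \<bullet> c" if "a \<in> tangent_space M x" "b \<in> tangent_space M x" for a b c
      using nabla_dproj_commute(1)[OF x that] by simp
  qed (use nabla_metric[OF x] nabla_tangent[OF x] u w in blast)+
  then show ?thesis by simp
qed

text \<open>On projected constant fields the covariant term of the Gauss splitting is zero, so the
  whole flat derivative is normal.\<close>

lemma second_fundamental_form_eq_dproj:
  assumes "second_fundamental_form M nabla II" "x \<in> M" "u \<in> tangent_space M x" "w \<in> tangent_space M x"
  shows "II x u w = dproj M x u w"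
proof -
  have P: "tproj M x v = v" if "v \<in> tangent_space M x" for v
    by (rule orth_proj_ident[OF subspace_tangent_space[OF embedded assms(2)] that])
  have "flat_D M (\<lambda>y. tproj M y u) (\<lambda>y. tproj M y w) x =
      nabla (\<lambda>y. tproj M y u) (\<lambda>y. tproj M y w) x + II x (tproj M x u) (tproj M x w)"
    by (rule assms(1)[unfolded second_fundamental_form_def, rule_format,
          OF vector_field_tproj[OF embedded] vector_field_tproj[OF embedded] assms(2)])
  then show ?thesis
    using nabla_tproj_zero[OF assms(2-4)] flat_D_tproj[OF assms(2,3)] P assms(3,4) by simp
qed

text \<open>Both sides are tangent, so it is enough to pair them with tangent vectors; there
  self-adjointness of \<open>dproj\<close> moves it from the normal vector onto the tangent one,
  where it is \<open>II\<close>.\<close>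

lemma weingarten_eq_dproj:
  assumes sff: "second_fundamental_form M nabla II" and wm: "weingarten_map M g II A"
    and x: "x \<in> M" and u: "u \<in> tangent_space M x" and \<xi>: "\<xi> \<in> normal_space_at M x"
  shows "A x \<xi> u = - dproj M x u \<xi>"
proof -
  have sub: "subspace (tangent_space M x)" by (rule subspace_tangent_space[OF embedded x])
  have P: "tproj M x v = v" if "v \<in> tangent_space M x" for v
    by (rule orth_proj_ident[OF sub that])
  have P0: "tproj M x \<xi> = 0" using \<xi> orth_proj_zero_iff[OF sub] by blast
  have wm': "A x (\<xi> - tproj M x \<xi>) (tproj M x u) \<in> tangent_space M x \<and>
      g x (A x (\<xi> - tproj M x \<xi>) (tproj M x u)) (tproj M x w) =
        - inner (\<xi> - tproj M x \<xi>) (II x (tproj M x u) (tproj M x w))" for w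
    by (rule wm[unfolded weingarten_map_def, rule_format, OF normal_field_tproj[OF embedded]
          vector_field_tproj[OF embedded] vector_field_tproj[OF embedded] x])
  have A: "A x \<xi> u \<in> tangent_space M x" using wm' P0 P u by simp
  have "(A x \<xi> u + dproj M x u \<xi>) \<bullet> w = 0" if w: "w \<in> tangent_space M x" for w
  proof -
    have "A x \<xi> u \<bullet> w = - (\<xi> \<bullet> II x u w)"
      using wm'[of w] P0 P u w A metric_eq_inner[OF x A w] by simp
    also have "\<dots> = - (dproj M x u \<xi> \<bullet> w)"
      using second_fundamental_form_eq_dproj[OF sff x u w] dproj_adjoint[OF embedded x u] by simp
    finally show ?thesis by (simp add: inner_add_left)
  qed
  then have "A x \<xi> u + dproj M x u \<xi> \<in> normal_space_at M x"
    by (simp add: orthogonal_comp_def orthogonal_def inner_commute)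
  moreover have "A x \<xi> u + dproj M x u \<xi> \<in> tangent_space M x"
    by (intro subspace_add[OF sub] A dproj_normal[OF embedded x u \<xi>])
  ultimately have "A x \<xi> u + dproj M x u \<xi> = 0" using tangent_normal_zero by blast
  then show ?thesis by (simp add: eq_neg_iff_add_eq_0)
qed

end

section \<open>The map gamma and its complete lift\<close>

text \<open>Only the base point needs an extension: the second point enters through an ambient
  difference and may be arbitrary.\<close>

definition gamma_ext :: "('a::euclidean_space \<Rightarrow> 'a \<Rightarrow> 'a) \<Rightarrow> 'a \<times> 'a \<Rightarrow> 'a \<times> 'a" where
  "gamma_ext F z = (fst z, F (fst z) (snd z - fst z))"

lemma smooth_open_gamma_ext:
  fixes M U :: "'a::euclidean_space set"
  assumes emb: "embedded_submanifold n M" and F: "proj_extension M U F"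
  shows "smooth_open (U \<times> UNIV) (gamma_ext F)"
proof -
  note F' = proj_extensionD[OF F]
  have op: "open (U \<times> (UNIV :: 'a set))" using F'(1) by (simp add: open_Times)
  have fst: "smooth_open (U \<times> (UNIV :: 'a set)) fst" and snd: "smooth_open (U \<times> (UNIV :: 'a set)) snd"
    using smooth_open_bounded_linear[OF bounded_linear_fst op] smooth_open_bounded_linear[OF bounded_linear_snd op]
    by auto
  have "smooth_open (U \<times> UNIV) (\<lambda>z. F (fst z) (snd z - fst z))"
  proof (rule smooth_open_apply_linear[OF op, where F = "\<lambda>z. F (fst z)"])
    show "linear (F (fst z))" if "z \<in> U \<times> (UNIV :: 'a set)" for z
      using that proj_extension_linear(1)[OF emb F] by auto
    show "smooth_open (U \<times> (UNIV :: 'a set)) (\<lambda>z. F (fst z) b)" for b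
      by (rule smooth_open_compose[OF op fst F'(2)]) auto
    show "smooth_open (U \<times> UNIV) (\<lambda>z. snd z - fst z)"
      by (rule smooth_open_diff[OF op snd fst])
  qed
  then show ?thesis
    unfolding gamma_ext_def by (rule smooth_open_Pair[OF op fst])
qed

lemma gamma_ext_eq:
  assumes "proj_extension M U F" "z \<in> M \<times> M" "z \<in> U \<times> UNIV"
  shows "gamma_ext F z = gamma M z"
  using assms(2,3) proj_extensionD(3)[OF assms(1)] by (auto simp: gamma_ext_def gamma_def)

lemma gamma_mem:
  assumes "embedded_submanifold n M" "z \<in> M \<times> M"
  shows "gamma M z \<in> tangent_bundle M"
  using assms orth_proj_mem[OF subspace_tangent_space[OF assms(1)]]
  by (auto simp: gamma_def tangent_bundle_def)

lemma gamma_ext_derivative: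
  assumes emb: "embedded_submanifold n M" and F: "proj_extension M U F"
    and x: "x \<in> U" "x \<in> M" and u: "u \<in> tangent_space M x"
  shows "frechet_derivative (gamma_ext F) (at (x, y)) (u, v) = (u, dproj M x u (y - x) + tproj M x (v - u))"
proof -
  note F' = proj_extensionD[OF F]
  have op: "open (U \<times> (UNIV :: 'a set))" using F'(1) by (simp add: open_Times)
  have "((\<lambda>z. F (fst z) (snd z - fst z)) has_derivative
      (\<lambda>h. frechet_derivative (\<lambda>z. F z (snd (x, y) - fst (x, y))) (at x) (fst h) +
        F (fst (x, y)) (snd h - fst h))) (at (x, y))"
  proof (rule has_derivative_apply_linear[OF op, where F = "\<lambda>z. F (fst z)"])
    show "linear (F (fst z))" if "z \<in> U \<times> (UNIV :: 'a set)" for z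
      using that proj_extension_linear(1)[OF emb F] by auto
    show "((\<lambda>z. F (fst z) b) has_derivative (\<lambda>h. frechet_derivative (\<lambda>z. F z b) (at x) (fst h))) (at (x, y))"
      for b
      using has_derivative_compose[OF has_derivative_fst[OF has_derivative_ident],
          of "\<lambda>z. F z b" _ "(x, y)"] proj_extension_has_derivative[OF F x(1)] by auto
    show "((\<lambda>z. snd z - fst z) has_derivative (\<lambda>h. snd h - fst h)) (at (x, y))"
      by (auto intro!: derivative_eq_intros)
  qed (use x in auto)
  then have "(gamma_ext F has_derivative (\<lambda>h. (fst h, frechet_derivative (\<lambda>z. F z (y - x)) (at x) (fst h) +
        F x (snd h - fst h)))) (at (x, y))"
    unfolding gamma_ext_def by (auto intro!: has_derivative_Pair has_derivative_fst)
  from frechet_derivative_at[OF this, symmetric] show ?thesis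
    using dproj_eq[OF F x u] F'(3)[OF x(2,1)] by simp
qed

text \<open>The membership claim is what permits evaluating the flip on this vector.\<close>

lemma tangent_map_gamma:
  assumes emb: "embedded_submanifold n M" and x: "x \<in> M" and y: "y \<in> M"
    and u: "u \<in> tangent_space M x" and v: "v \<in> tangent_space M y"
  shows "tangent_map (M \<times> M) (gamma M) ((x, y), (u, v)) =
      ((x, tproj M x (y - x)), (u, dproj M x u (y - x) + tproj M x (v - u)))"
    and "tangent_map (M \<times> M) (gamma M) ((x, y), (u, v)) \<in> tangent_bundle (tangent_bundle M)"
proof -
  obtain U F where U: "x \<in> U" and F: "proj_extension M U F"
    using proj_extension_exists[OF emb x] by blast
  have op: "open (U \<times> (UNIV :: 'a set))" using proj_extensionD(1)[OF F] by (simp add: open_Times)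
  note sm = smooth_open_gamma_ext[OF emb F] and eq = gamma_ext_eq[OF F]
  note uv = tangent_space_Times[OF u v]
  have xy: "(x, y) \<in> U \<times> UNIV" "(x, y) \<in> M \<times> M" using U x y by auto
  have 1: "mdiff (M \<times> M) (gamma M) (x, y) (u, v) = frechet_derivative (gamma_ext F) (at (x, y)) (u, v)"
    by (rule mdiff_eq[OF op smooth_open_has_derivative[OF sm xy(1)] xy eq uv])
  have "frechet_derivative (gamma_ext F) (at (x, y)) (u, v) \<in>
      tangent_space (tangent_bundle M) (gamma_ext F (x, y))"
    by (rule derivative_mem_tangent_space[OF op sm xy(1) _ uv]) (use eq gamma_mem[OF emb] in metis)
  with 1 show "tangent_map (M \<times> M) (gamma M) ((x, y), (u, v)) \<in> tangent_bundle (tangent_bundle M)"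
    using eq[OF xy(2,1)] gamma_mem[OF emb xy(2)] by (simp add: tangent_map_def tangent_bundle_def[of "tangent_bundle M"])
  show "tangent_map (M \<times> M) (gamma M) ((x, y), (u, v)) =
      ((x, tproj M x (y - x)), (u, dproj M x u (y - x) + tproj M x (v - u)))"
    using 1 gamma_ext_derivative[OF emb F U x u] by (simp add: tangent_map_def gamma_def)
qed

text \<open>An extrinsic form of the lift, free of any connection; \<open>II\<close> and
  \<open>A\<close> replace \<open>dproj\<close> only at the very end.\<close>

lemma gamma_cl_eq:
  assumes emb: "embedded_submanifold n M" and x: "x \<in> M" and y: "y \<in> M"
    and u: "u \<in> tangent_space M x" and v: "v \<in> tangent_space M y"
  shows "gamma_cl M ((x, u), (y, v)) =
      ((x, u), (tproj M x (y - x), dproj M x u (y - x) + tproj M x (v - u)))"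
    and "gamma_cl M ((x, u), (y, v)) \<in> tangent_bundle (tangent_bundle M)"
  using canonical_flip_tangent[OF emb tangent_map_gamma(2)[OF assms]] tangent_map_gamma(1)[OF assms]
  by (simp_all add: gamma_cl_def)

text \<open>Near each point the complete lift is the flipped tangent map of \<open>gamma_ext F\<close>.\<close>

lemma ck_map_gamma_cl:
  fixes M :: "'a::euclidean_space set"
  assumes emb: "embedded_submanifold n M"
  shows "ck_map k (tangent_bundle M \<times> tangent_bundle M) (gamma_cl M)"
  unfolding ck_map_def
proof
  fix p assume "p \<in> tangent_bundle M \<times> tangent_bundle M"
  then have p: "fst (fst p) \<in> M" by (auto simp: tangent_bundle_def)
  obtain U F where U: "fst (fst p) \<in> U" and F: "proj_extension M U F"
    using proj_extension_exists[OF emb p] by blast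
  note G = smooth_open_gamma_ext[OF emb F]
  define \<Omega> :: "(('a \<times> 'a) \<times> ('a \<times> 'a)) set" where "\<Omega> = (U \<times> UNIV) \<times> UNIV"
  \<comment> \<open>The regrouped pairs pass from the product of two bundles to the bundle of the
    product; the order of the final entries is that of \<open>swap23\<close>.\<close>
  define H where "H q = (let b = (fst (fst q), fst (snd q));
    d = frechet_derivative (gamma_ext F) (at b) (snd (fst q), snd (snd q))
    in ((fst (gamma_ext F b), fst d), (snd (gamma_ext F b), snd d)))" for q
  have op: "open \<Omega>" using proj_extensionD(1)[OF F] by (simp add: \<Omega>_def open_Times)
  have comps: "smooth_open \<Omega> (\<lambda>q. (fst (fst q), fst (snd q)))" "smooth_open \<Omega> (\<lambda>q. (snd (fst q), snd (snd q)))"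
    by (intro smooth_open_Pair smooth_open_fst smooth_open_snd smooth_open_ident op)+
  have H: "smooth_open \<Omega> H"
    unfolding H_def Let_def
    by (intro smooth_open_Pair smooth_open_fst smooth_open_snd op smooth_open_compose[OF op comps(1) G]
        smooth_open_deriv_apply[OF op G comps]) (auto simp: \<Omega>_def)
  have "H q = gamma_cl M q" if q: "q \<in> (tangent_bundle M \<times> tangent_bundle M) \<inter> \<Omega>" for q
  proof -
    obtain x u y v where qc: "q = ((x, u), (y, v))" by (metis surj_pair)
    then have m: "x \<in> M" "y \<in> M" "u \<in> tangent_space M x" "v \<in> tangent_space M y" "x \<in> U"
      using q by (auto simp: tangent_bundle_def \<Omega>_def)
    show ?thesis
      unfolding qc gamma_cl_eq(1)[OF emb m(1-4)]
      using gamma_ext_derivative[OF emb F m(5,1,3)] proj_extensionD(3)[OF F m(1,5)]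
      by (simp add: H_def Let_def gamma_ext_def[of F "(x, y)"])
  qed
  moreover have "p \<in> \<Omega>" using U by (simp add: \<Omega>_def mem_Times_iff)
  ultimately show "\<exists>U F. open U \<and> p \<in> U \<and> ck_open k U F \<and>
      (\<forall>x\<in>tangent_bundle M \<times> tangent_bundle M \<inter> U. F x = gamma_cl M x)"
    using op smooth_open_imp_ck[OF H] by blast
qed

section \<open>The connection rule axioms for the lift\<close>

lemma ck_map_continuous_on:
  assumes "ck_map k S f"
  shows "continuous_on S f"
  unfolding continuous_on_eq_continuous_within
proof
  fix p assume p: "p \<in> S"
  obtain U F where U: "open U" "p \<in> U" "ck_open k U F" "\<forall>x\<in>S \<inter> U. F x = f x"
    using bspec[OF assms[unfolded ck_map_def] p] by blast
  have "continuous (at p within S) F"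
    using ck_open_continuous[OF U(3)] U(1,2)
    by (simp add: continuous_on_eq_continuous_at continuous_at_imp_continuous_at_within)
  moreover obtain d where "0 < d" "ball p d \<subseteq> U" using U(1,2) open_contains_ball by metis
  ultimately show "continuous (at p within S) f"
    using U(4) p by (intro continuous_transform_within[of p S F d f]) (auto simp: dist_commute subset_iff)
qed

text \<open>On the tangent bundle the fibre coordinate satisfies \<open>P v = v\<close>; differentiate this.\<close>

lemma tangent_tangent_bundle:
  assumes emb: "embedded_submanifold n M" and x: "x \<in> M" and u: "u \<in> tangent_space M x"
    and hk: "(h, k) \<in> tangent_space (tangent_bundle M) (x, u)"
  shows "h \<in> tangent_space M x" and "dproj M x h u + tproj M x k = k"
proof -
  have "frechet_derivative fst (at (x, u)) (h, k) \<in> tangent_space M (fst (x, u))"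
    by (rule derivative_mem_tangent_space[OF open_UNIV smooth_open_bounded_linear[OF bounded_linear_fst open_UNIV]
          UNIV_I _ hk]) (auto simp: tangent_bundle_def)
  then show h: "h \<in> tangent_space M x"
    by (simp add: frechet_derivative_at[OF has_derivative_fst[OF has_derivative_ident], symmetric])
  obtain U F where U: "x \<in> U" and F: "proj_extension M U F"
    using proj_extension_exists[OF emb x] by blast
  note F' = proj_extensionD[OF F]
  have op: "open (U \<times> (UNIV :: 'a set))" using F'(1) by (simp add: open_Times)
  have "((\<lambda>z. F (fst z) (snd z)) has_derivative
      (\<lambda>h. frechet_derivative (\<lambda>z. F z (snd (x, u))) (at x) (fst h) + F (fst (x, u)) (snd h))) (at (x, u))"
  proof (rule has_derivative_apply_linear[OF op, where F = "\<lambda>z. F (fst z)"])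
    show "linear (F (fst z))" if "z \<in> U \<times> (UNIV :: 'a set)" for z
      using that proj_extension_linear(1)[OF emb F] by auto
    show "((\<lambda>z. F (fst z) b) has_derivative (\<lambda>h. frechet_derivative (\<lambda>z. F z b) (at x) (fst h))) (at (x, u))"
      for b
      using has_derivative_compose[OF has_derivative_fst[OF has_derivative_ident],
          of "\<lambda>z. F z b" _ "(x, u)"] proj_extension_has_derivative[OF F U] by auto
    show "(snd has_derivative snd) (at (x, u))"
      by (rule has_derivative_snd[OF has_derivative_ident])
  qed (use U in auto)
  then have d: "((\<lambda>z. F (fst z) (snd z) - snd z) has_derivative
      (\<lambda>h. frechet_derivative (\<lambda>z. F z u) (at x) (fst h) + F x (snd h) - snd h)) (at (x, u))"
    by (auto intro!: has_derivative_diff has_derivative_snd)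
  have xu: "(x, u) \<in> tangent_bundle M" using x u by (simp add: tangent_bundle_def)
  \<comment> \<open>The difference vanishes on the bundle and so extends the zero function, as the
    constant zero does; \<open>mdiff_eq\<close> equates the two resulting differentials.\<close>
  have "mdiff (tangent_bundle M) (\<lambda>_. 0) (x, u) (h, k) =
      frechet_derivative (\<lambda>z. F z u) (at x) (fst (h, k)) + F x (snd (h, k)) - snd (h, k)"
  proof (rule mdiff_eq[OF op d _ xu _ hk])
    show "F (fst z) (snd z) - snd z = 0" if z: "z \<in> tangent_bundle M" "z \<in> U \<times> UNIV" for z
    proof -
      have "fst z \<in> M" "snd z \<in> tangent_space M (fst z)" "fst z \<in> U"
        using z by (auto simp: tangent_bundle_def)
      then show ?thesis
        using F'(3) orth_proj_ident[OF subspace_tangent_space[OF emb]] by simp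
    qed
  qed (use U in simp)
  moreover have "mdiff (tangent_bundle M) (\<lambda>_. 0 :: 'a) (x, u) (h, k) = 0"
    by (rule mdiff_eq[OF open_UNIV has_derivative_const UNIV_I xu refl hk])
  ultimately show "dproj M x h u + tproj M x k = k"
    using dproj_eq[OF F U x h] F'(3)[OF x U] by simp
qed

text \<open>The hypothesis \<open>sym\<close> serves the clause on the differential: the formula
  contributes \<open>dproj M x u h\<close>, whereas tangency of \<open>(h, k)\<close> to the bundle
  speaks of \<open>dproj M x h u\<close>.\<close>

lemma connection_rule_gamma_cl:
  fixes M :: "'a::euclidean_space set"
  assumes emb: "embedded_submanifold n M"
    and sym: "\<And>x u w. x \<in> M \<Longrightarrow> u \<in> tangent_space M x \<Longrightarrow> w \<in> tangent_space M x \<Longrightarrow>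
      dproj M x u w = dproj M x w u"
  shows "connection_rule (tangent_bundle M) (gamma_cl M)"
  unfolding connection_rule_def
proof (intro conjI)
  let ?N = "tangent_bundle M"
  have mem: "gamma_cl M (p, q) \<in> tangent_bundle ?N" "fst (gamma_cl M (p, q)) = p"
    if "p \<in> ?N" "q \<in> ?N" for p q
  proof -
    have "fst p \<in> M" "fst q \<in> M" "snd p \<in> tangent_space M (fst p)" "snd q \<in> tangent_space M (fst q)"
      using that by (auto simp: tangent_bundle_def)
    from gamma_cl_eq[OF emb this] show "gamma_cl M (p, q) \<in> tangent_bundle ?N" "fst (gamma_cl M (p, q)) = p"
      by simp_all
  qed
  show "\<exists>n. embedded_submanifold n ?N" using embedded_submanifold_tangent_bundle[OF emb] by blast
  show "gamma_cl M \<in> measurable (restrict_space borel (?N \<times> ?N)) (restrict_space borel (tangent_bundle ?N))"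
  proof (rule measurable_restrict_space2)
    show "gamma_cl M \<in> space (restrict_space borel (?N \<times> ?N)) \<rightarrow> tangent_bundle ?N"
      using mem(1) by (auto simp: space_restrict_space)
    show "gamma_cl M \<in> borel_measurable (restrict_space borel (?N \<times> ?N))"
      by (rule borel_measurable_continuous_on_restrict[OF ck_map_continuous_on[OF ck_map_gamma_cl[OF emb, of 0]]])
  qed
  show "\<exists>W. open W \<and> (\<forall>x\<in>?N. (x, x) \<in> W) \<and> ck_map 2 (W \<inter> (?N \<times> ?N)) (gamma_cl M)"
    using ck_map_gamma_cl[OF emb, of 2] by (intro exI[of _ UNIV]) simp
  show "\<forall>x\<in>?N. \<forall>y\<in>?N. fst (gamma_cl M (x, y)) = x \<and> snd (gamma_cl M (x, y)) \<in> tangent_space ?N x"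
  proof (intro ballI conjI)
    fix p q assume "p \<in> ?N" "q \<in> ?N"
    from mem[OF this] show "fst (gamma_cl M (p, q)) = p" "snd (gamma_cl M (p, q)) \<in> tangent_space ?N p"
      by (auto simp: tangent_bundle_def[of ?N])
  qed
  have N: "fst p \<in> M" "snd p \<in> tangent_space M (fst p)" if "p \<in> ?N" for p
    using that by (auto simp: tangent_bundle_def)
  show "\<forall>x\<in>?N. gamma_cl M (x, x) = (x, 0)"
  proof
    fix p assume p: "p \<in> ?N"
    show "gamma_cl M (p, p) = (p, 0)"
      using gamma_cl_eq(1)[OF emb N(1)[OF p] N(1)[OF p] N(2)[OF p] N(2)[OF p]]
        linear_0[OF linear_orth_proj[OF subspace_tangent_space[OF emb N(1)[OF p]]]]
        linear_0[OF linear_dproj[OF emb N[OF p]]]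
      by (simp add: zero_prod_def)
  qed
  show "\<forall>x\<in>?N. \<exists>L. ((\<lambda>y. snd (gamma_cl M (x, y))) has_derivative L) (at x within ?N) \<and>
        (\<forall>v\<in>tangent_space ?N x. L v = v)"
  proof
    fix p assume p: "p \<in> ?N"
    obtain x u where pc: "p = (x, u)" by (metis surj_pair)
    have x: "x \<in> M" and u: "u \<in> tangent_space M x" using p pc by (auto simp: tangent_bundle_def)
    \<comment> \<open>For fixed \<open>p\<close> the closed formula is affine in \<open>q\<close>;
      this is its linear part.\<close>
    define L where "L h = (tproj M x (fst h), dproj M x u (fst h) + tproj M x (snd h))" for h
    have sub: "subspace (tangent_space M x)" by (rule subspace_tangent_space[OF emb x])
    have bl: "bounded_linear (tproj M x)" "bounded_linear (dproj M x u)"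
      using linear_orth_proj[OF sub] linear_dproj[OF emb x u] by (simp_all add: linear_conv_bounded_linear)
    have d: "((\<lambda>q. (tproj M x (fst q - x), dproj M x u (fst q - x) + tproj M x (snd q - u))) has_derivative L) (at p)"
      unfolding L_def
      by (rule derivative_eq_intros bounded_linear.has_derivative[OF bl(1)] bounded_linear.has_derivative[OF bl(2)] refl | simp)+
    have "((\<lambda>q. snd (gamma_cl M (p, q))) has_derivative L) (at p within ?N)"
    proof (rule has_derivative_transform[OF p _ has_derivative_at_withinI[OF d]])
      fix q assume q: "q \<in> ?N"
      show "snd (gamma_cl M (p, q)) = (tproj M x (fst q - x), dproj M x u (fst q - x) + tproj M x (snd q - u))"
        using gamma_cl_eq(1)[OF emb x N(1)[OF q] u N(2)[OF q]] pc by simp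
    qed
    moreover have "L v = v" if v: "v \<in> tangent_space ?N p" for v
    proof -
      obtain h k where vc: "v = (h, k)" by (metis surj_pair)
      note hk = tangent_tangent_bundle[OF emb x u v[unfolded vc pc]]
      show ?thesis using hk(2) sym[OF x u hk(1)] orth_proj_ident[OF sub hk(1)] by (simp add: L_def vc)
    qed
    ultimately show "\<exists>L. ((\<lambda>q. snd (gamma_cl M (p, q))) has_derivative L) (at p within ?N) \<and>
        (\<forall>v\<in>tangent_space ?N p. L v = v)" by blast
  qed
qed

theorem proposition2p1:
  fixes M :: "'a::euclidean_space set" and m :: nat
    and g :: "'a \<Rightarrow> 'a \<Rightarrow> 'a \<Rightarrow> real"
    and nabla :: "('a \<Rightarrow> 'a) \<Rightarrow> ('a \<Rightarrow> 'a) \<Rightarrow> 'a \<Rightarrow> 'a"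
    and II A :: "'a \<Rightarrow> 'a \<Rightarrow> 'a \<Rightarrow> 'a"
  assumes "riemannian_submanifold m M g"
    and "properly_embedded M"
    and "levi_civita M g nabla"
    and "second_fundamental_form M nabla II"
    and "weingarten_map M g II A"
  shows "(\<forall>x\<in>M. \<forall>y\<in>M. \<forall>u\<in>tangent_space M x. \<forall>v\<in>tangent_space M y.
            gamma_cl M ((x, u), (y, v)) =
              ((x, u),
               (snd (gamma M (x, y)), II x (snd (gamma M (x, y))) u) +
               (0, - A x (orth_proj (normal_space_at M x) (y - x)) u
                   + orth_proj (tangent_space M x) (v - u)))) \<and>
         connection_rule (tangent_bundle M) (gamma_cl M)"
proof
  note lc = assms(1,3)
  note emb = embedded[OF lc]
  note sym = nabla_dproj_commute(2)[OF lc]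
  show "connection_rule (tangent_bundle M) (gamma_cl M)"
    by (rule connection_rule_gamma_cl[OF emb sym])
  show "\<forall>x\<in>M. \<forall>y\<in>M. \<forall>u\<in>tangent_space M x. \<forall>v\<in>tangent_space M y.
            gamma_cl M ((x, u), (y, v)) =
              ((x, u),
               (snd (gamma M (x, y)), II x (snd (gamma M (x, y))) u) +
               (0, - A x (orth_proj (normal_space_at M x) (y - x)) u
                   + orth_proj (tangent_space M x) (v - u)))"
  proof (intro ballI)
    fix x y u v
    assume x: "x \<in> M" and y: "y \<in> M" and u: "u \<in> tangent_space M x" and v: "v \<in> tangent_space M y"
    have sub: "subspace (tangent_space M x)" by (rule subspace_tangent_space[OF emb x])
    let ?p = "tproj M x (y - x)" and ?n = "orth_proj (normal_space_at M x) (y - x)"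
    have p: "?p \<in> tangent_space M x" and n: "?n \<in> normal_space_at M x"
      by (rule orth_proj_mem[OF sub], rule orth_proj_mem[OF subspace_orthogonal_comp])
    \<comment> \<open>The tangential part of \<open>y - x\<close> yields the \<open>II\<close> term,
      the normal part the Weingarten term.\<close>
    have "dproj M x u (y - x) = dproj M x u (?p + ?n)"
      by (simp add: orth_proj_orthogonal_comp[OF sub])
    also have "\<dots> = dproj M x u ?p + dproj M x u ?n"
      by (rule linear_add[OF linear_dproj[OF emb x u]])
    \<comment> \<open>\<open>II x ?p u\<close> is a derivative in direction \<open>?p\<close>;
      symmetry turns it into one in direction \<open>u\<close>.\<close>
    also have "dproj M x u ?p = II x ?p u"
      using second_fundamental_form_eq_dproj[OF lc assms(4) x p u] sym[OF x u p] by simp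
    also have "dproj M x u ?n = - A x ?n u"
      using weingarten_eq_dproj[OF lc assms(4,5) x u n] by simp
    finally show "gamma_cl M ((x, u), (y, v)) =
              ((x, u),
               (snd (gamma M (x, y)), II x (snd (gamma M (x, y))) u) +
               (0, - A x ?n u + orth_proj (tangent_space M x) (v - u)))"
      using gamma_cl_eq(1)[OF emb x y u v] by (simp add: gamma_def)
  qed
qed

end
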